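(* Let $n\ge1$ be a given degree. For $\omega\in(0,(n+1)\pi)$ the equioscillation points $\eta_1(\omega)<\dots<\eta_{2n+2}(\omega)$ and the interpolation nodes $\mathrm{i}x_1(\omega),\dots,\mathrm{i}x_{2n+1}(\omega)$ (with $x_1(\omega)<\dots<x_{2n+1}(\omega)$) of the best approximation to $\mathrm{e}^{\mathrm{i}\omega x}$ in $\mathcal{U}_n$ depend continuously on $\omega$.
   Context: For a complex polynomial $p$ let $p^\dag(z):=\overline{p}(-z)=\overline{p(-\overline z)}$, where $\overline p$ has complex-conjugated coefficients. Let $\mathcal{U}_n:=\{p^\dag/p : p \text{ a complex polynomial of degree}\le n,\ p\not\equiv 0\}$, with rational functions identified with their irreducible form; then $|r(\mathrm{i}x)|=1$ for $r\in\mathcal{U}_n$, $x\in\mathbb{R}$. For $r\in\mathcal{U}_n$, $\|r-\exp(\omega\cdot)\|:=\max_{x\in[-1,1]}|r(\mathrm{i}x)-\mathrm{e}^{\mathrm{i}\omega x}|$. For $\omega\in(0,(n+1)\pi)$ the best approximation $r_\omega$ is the (existing and unique) element of $\mathcal{U}_n$ with $\|r_\omega-\exp(\omega\cdot)\|=\min_{u\in\mathcal{U}_n}\|u-\exp(\omega\cdot)\|$; this minimum is $<2$. Phase function: if $r\in\mathcal{U}_n$ (in irreducible form) has poles $s_j=\xi_j+\mathrm{i}\mu_j$, $j=1,\dots,m$ (then $\xi_j\neq0$), and $\|r-\exp(\omega\cdot)\|<2$, then there is a unique function of the form $g(x)=\theta+2\sum_{j=1}^m\arctan\big(\frac{x-\mu_j}{\xi_j}\big)$,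 $\theta\in\mathbb{R}$, with $r(\mathrm{i}x)=\mathrm{e}^{\mathrm{i}g(x)}$ for $x\in\mathbb{R}$ and $\max_{x\in[-1,1]}|g(x)-\omega x|<\pi$. The phase error is $g(x)-\omega x$. For the best approximation with $\omega\in(0,(n+1)\pi)$ there are exactly $2n+2$ points $-1=\eta_1<\dots<\eta_{2n+2}=1$ in $[-1,1]$ at which $|g(x)-\omega x|$ attains its maximum over $[-1,1]$, and the sign of the phase error alternates between consecutive ones; these are the equioscillation points. The phase error has exactly one zero $x_j\in(\eta_j,\eta_{j+1})$ for $j=1,\dots,2n+1$; the points $\mathrm{i}x_1,\dots,\mathrm{i}x_{2n+1}$ are the interpolation nodes (where $r_\omega(\mathrm{i}x_j)=\mathrm{e}^{\mathrm{i}\omega x_j}$). *)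

theory Defs
  imports
    "HOL-Analysis.Analysis"
    "HOL-Computational_Algebra.Computational_Algebra"
    "HOL-Computational_Algebra.Field_as_Ring"
begin

text \<open>Complex rational functions are elements of the fraction field \<^typ>\<open>complex poly fract\<close>;
  \<^const>\<open>quot_of_fract\<close> yields the irreducible form, with monic denominator.\<close>

type_synonym ratfun = "complex poly fract"

definition rat_num :: "ratfun \<Rightarrow> complex poly" where
  "rat_num r = fst (quot_of_fract r)"

definition rat_den :: "ratfun \<Rightarrow> complex poly" where
  "rat_den r = snd (quot_of_fract r)"

definition rat_eval :: "ratfun \<Rightarrow> complex \<Rightarrow> complex" where
  "rat_eval r z = poly (rat_num r) z / poly (rat_den r) z"

definition pdagger :: "complex poly \<Rightarrow> complex poly" where
  "pdagger p = map_poly cnj p \<circ>\<^sub>p [:0, -1:]"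

definition unitary_rat :: "nat \<Rightarrow> ratfun set" where
  "unitary_rat n = {Fraction_Field.Fract (pdagger p) p | p. degree p \<le> n \<and> p \<noteq> 0}"

text \<open>All functions to which this is applied are continuous on \<open>[-1,1]\<close>, so the supremum is
  a maximum.\<close>

definition max_norm :: "(real \<Rightarrow> 'a::real_normed_vector) \<Rightarrow> real" where
  "max_norm f = (SUP x\<in>{-1..1}. norm (f x))"

definition approx_error :: "real \<Rightarrow> ratfun \<Rightarrow> real" where
  "approx_error \<omega> r =
     max_norm (\<lambda>x. rat_eval r (\<i> * complex_of_real x) - exp (\<i> * complex_of_real (\<omega> * x)))"

definition best_approx :: "nat \<Rightarrow> real \<Rightarrow> ratfun" where
  "best_approx n \<omega> = (THE r. r \<in> unitary_rat n \<and>
     (\<forall>u\<in>unitary_rat n. approx_error \<omega> r \<le> approx_error \<omega> u))"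

text \<open>The multiset \<open>proots (rat_den r)\<close> lists the poles of \<open>r\<close> with multiplicity.\<close>

definition is_phase_function :: "real \<Rightarrow> ratfun \<Rightarrow> (real \<Rightarrow> real) \<Rightarrow> bool" where
  "is_phase_function \<omega> r g \<longleftrightarrow>
     (\<exists>\<theta>. \<forall>x. g x = \<theta> + 2 * (\<Sum>s\<in>#proots (rat_den r). arctan ((x - Im s) / Re s))) \<and>
     (\<forall>x. rat_eval r (\<i> * complex_of_real x) = exp (\<i> * complex_of_real (g x))) \<and>
     max_norm (\<lambda>x. g x - \<omega> * x) < pi"

definition phase_function :: "real \<Rightarrow> ratfun \<Rightarrow> real \<Rightarrow> real" where
  "phase_function \<omega> r = (THE g. is_phase_function \<omega> r g)"

definition phase_error :: "nat \<Rightarrow> real \<Rightarrow> real \<Rightarrow> real" where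
  "phase_error n \<omega> x = phase_function \<omega> (best_approx n \<omega>) x - \<omega> * x"

definition is_equioscillation_list :: "nat \<Rightarrow> real \<Rightarrow> real list \<Rightarrow> bool" where
  "is_equioscillation_list n \<omega> hs \<longleftrightarrow>
     length hs = 2 * n + 2 \<and> sorted_wrt (<) hs \<and> hd hs = -1 \<and> last hs = 1 \<and>
     set hs = {x\<in>{-1..1}. \<bar>phase_error n \<omega> x\<bar> = max_norm (phase_error n \<omega>)} \<and>
     (\<forall>k < 2 * n + 1. sgn (phase_error n \<omega> (hs ! Suc k)) = - sgn (phase_error n \<omega> (hs ! k)))"

text \<open>The points \<open>\<eta>\<^sub>j\<close> and \<open>x\<^sub>j\<close> are numbered from \<open>1\<close>, hence the index \<open>j - 1\<close>.\<close>

definition equioscillation_point :: "nat \<Rightarrow> real \<Rightarrow> nat \<Rightarrow> real" where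
  "equioscillation_point n \<omega> j = (THE hs. is_equioscillation_list n \<omega> hs) ! (j - 1)"

definition phase_error_zero :: "nat \<Rightarrow> real \<Rightarrow> nat \<Rightarrow> real" where
  "phase_error_zero n \<omega> j = (THE x.
     x \<in> {equioscillation_point n \<omega> j <..< equioscillation_point n \<omega> (j + 1)} \<and>
     phase_error n \<omega> x = 0)"

definition interpolation_node :: "nat \<Rightarrow> real \<Rightarrow> nat \<Rightarrow> complex" where
  "interpolation_node n \<omega> j = \<i> * complex_of_real (phase_error_zero n \<omega> j)"

end

theory Submission
  imports Defs
begin

text \<open>
For real \<open>x\<close> and \<open>r = p\<^sup>\<dagger> / p\<close> one has
\<open>r (\<i> x) = cnj (p (\<i> x)) / p (\<i> x)\<close>. Hence with the twisted polynomial
\<open>w x = p (\<i> x) * exp (\<i> \<omega> x / 2)\<close> the quotient \<open>r (\<i> x) / exp (\<i> \<omega> x)\<close> equals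
\<open>cnj w / w\<close>: the phase error is \<open>- 2 arctan \<tau>\<close> with \<open>\<tau> = Im w / Re w\<close>, and the
approximation error is an increasing function of the maximum of \<open>\<bar>\<tau>\<bar>\<close>. So best approximation
amounts to the homogeneous problem of finding the least \<open>M\<close> such that
\<open>\<bar>Im w\<bar> \<le> M \<bar>Re w\<bar>\<close> on \<open>[-1,1]\<close> for some \<open>p\<close> of degree at most \<open>n\<close>.
Since the twist is linear in \<open>p\<close>, compactness of the coefficient sphere and first-order
perturbations apply directly.

\<^item> A finite \<open>M\<close> exists for \<open>\<omega> < (n + 1) \<pi>\<close> (\<open>exists_positive_twist\<close>), and compactness
  then gives a minimiser (\<open>best_tan_attained\<close>).

\<^item> A minimiser of degree \<open>m\<close>, coprime to its reflection, has at least \<open>n + m + 2\<close> extremal points: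
  on fewer points a Bezout identity for \<open>p\<close> and \<open>p\<^sup>\<dagger>\<close> produces a perturbation that decreases
  \<open>\<bar>\<tau>\<bar>\<close> at all of them (\<open>extremal_card_ge\<close>). On the other hand \<open>\<tau>'\<close> is, up to a positive
  factor, a polynomial of exact degree \<open>2 m\<close>, which leaves room for at most \<open>2 m + 2\<close> extremal
  points, the two endpoints included. Both bounds together force \<open>m = n\<close>, exactly \<open>2 n + 2\<close>
  extremal points, and strict monotonicity of \<open>\<tau>\<close> between consecutive ones, which yields the
  alternation and the unique zero in between (\<open>best_poly_equioscillating\<close>).

\<^item> For a competitor \<open>q\<close> the polynomial \<open>Im (p cnj q)\<close> has degree at most \<open>2 n\<close> and weakly
  alternates at the \<open>2 n + 2\<close> extremal points, so it vanishes; hence \<open>q\<close> is a positive multiple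
  of \<open>p\<close> (\<open>best_poly_unique\<close>).

\<^item> If \<open>\<omega>\<^sub>k\<close> tends to \<open>\<omega>\<close>, the scaled best polynomials for \<open>\<omega>\<^sub>k\<close> accumulate only at
  minimisers for \<open>\<omega>\<close>, because the minimal \<open>M\<close> is upper semicontinuous in \<open>\<omega>\<close>. By uniqueness the
  phase error is jointly continuous in \<open>(\<omega>, x)\<close> (\<open>phase_error_tendsto\<close>). Accumulation points
  of the extremal points for \<open>\<omega>\<^sub>k\<close> are extremal for \<open>\<omega>\<close>, and they stay distinct because the phase
  errors at neighbours have opposite signs; as there are exactly \<open>2 n + 2\<close> extremal points
  for \<open>\<omega>\<close> as well, the \<open>j\<close>-th ones converge to the \<open>j\<close>-th one (\<open>extremal_tendsto\<close>). The zeros,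
  trapped between neighbours, follow (\<open>zero_tendsto\<close>).
\<close>

section \<open>Reflection in the imaginary axis and reduced fractions\<close>

lemma poly_pdagger: "poly (pdagger p) z = cnj (poly p (- cnj z))"
  using poly_cnj[of p "- cnj z"] by (simp add: pdagger_def poly_pcompose)

lemma poly_pdagger_imag [simp]:
  "poly (pdagger p) (\<i> * complex_of_real x) = cnj (poly p (\<i> * complex_of_real x))"
  by (simp add: poly_pdagger)

lemma complex_poly_ext: "(\<And>z. poly p z = poly q z) \<Longrightarrow> p = (q :: complex poly)"
  by (simp add: poly_eq_poly_eq_iff [symmetric] fun_eq_iff)

lemma pdagger_pdagger [simp]: "pdagger (pdagger p) = p"
  by (rule complex_poly_ext) (simp add: poly_pdagger)

lemma pdagger_diff: "pdagger (p - q) = pdagger p - pdagger q"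
  by (rule complex_poly_ext) (simp add: poly_pdagger)

lemma pdagger_mult: "pdagger (p * q) = pdagger p * pdagger q"
  by (rule complex_poly_ext) (simp add: poly_pdagger)

lemma pdagger_smult: "pdagger (smult c p) = smult (cnj c) (pdagger p)"
  by (rule complex_poly_ext) (simp add: poly_pdagger)

lemma pdagger_0 [simp]: "pdagger 0 = 0"
  by (rule complex_poly_ext) (simp add: poly_pdagger)

lemma pdagger_eq_0_iff [simp]: "pdagger p = 0 \<longleftrightarrow> p = 0"
  by (metis pdagger_0 pdagger_pdagger)

lemma degree_pdagger [simp]: "degree (pdagger p) = degree p"
  by (simp add: pdagger_def degree_pcompose degree_map_poly)

lemma pdagger_dvd_pdagger: "p dvd q \<Longrightarrow> pdagger p dvd pdagger q"
  by (metis dvdE dvdI pdagger_mult)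

lemma poly_eq_on_imaginary_axis:
  assumes "infinite S" and "\<And>x. x \<in> S \<Longrightarrow> poly p (\<i> * complex_of_real x) = poly q (\<i> * complex_of_real x)"
  shows "p = q"
proof (rule ccontr)
  assume "p \<noteq> q"
  then have "finite {z. poly (p - q) z = 0}"
    by (intro poly_roots_finite) simp
  moreover have "(\<lambda>x. \<i> * complex_of_real x) ` S \<subseteq> {z. poly (p - q) z = 0}"
    using assms(2) by auto
  moreover have "inj_on (\<lambda>x. \<i> * complex_of_real x) S"
    by (auto simp: inj_on_def)
  ultimately show False
    using assms(1) by (meson finite_imageD finite_subset)
qed

lemma same_degree_dvd_smult:
  fixes p q :: "'a::field poly"
  assumes "p dvd q" "degree q \<le> degree p" "q \<noteq> 0"
  obtains c where "c \<noteq> 0" "q = smult c p"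
proof -
  obtain k where k: "q = p * k" using assms(1) by (elim dvdE)
  with assms have "degree k = 0" by (simp add: degree_mult_eq)
  then obtain c where "k = [:c:]" by (elim degree_eq_zeroE)
  with k assms(3) show ?thesis using that[of c] by auto
qed

lemma coprime_pdagger_nonzero:
  assumes "coprime p (pdagger p)"
  shows "p \<noteq> 0"
  using assms by auto

lemma coprime_pdagger_no_imaginary_root:
  assumes "coprime p (pdagger p)"
  shows "poly p (\<i> * complex_of_real x) \<noteq> 0"
proof
  assume "poly p (\<i> * complex_of_real x) = 0"
  then have "[:- (\<i> * complex_of_real x), 1:] dvd p" "[:- (\<i> * complex_of_real x), 1:] dvd pdagger p"
    by (simp_all flip: poly_eq_0_iff_dvd)
  with assms have "is_unit [:- (\<i> * complex_of_real x), 1:]"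
    by (rule coprime_common_divisor)
  then show False by (simp add: is_unit_poly_iff)
qed

text \<open>The greatest common divisor \<open>g\<close> of \<open>p\<close> and \<open>p\<^sup>\<dagger>\<close> satisfies \<open>g = c g\<^sup>\<dagger>\<close> with \<open>\<bar>c\<bar> = 1\<close>;
multiplied by the conjugate of a square root of \<open>c\<close> it becomes invariant under reflection, so the
factor that is cancelled is real on the imaginary axis.\<close>

lemma pdagger_reduce:
  assumes "p \<noteq> 0"
  obtains p0 d where "p = p0 * d" "d \<noteq> 0" "pdagger d = d" "coprime p0 (pdagger p0)"
proof -
  define g where "g = gcd p (pdagger p)"
  have g0: "g \<noteq> 0" using assms by (simp add: g_def)
  have "pdagger g dvd pdagger p" "pdagger g dvd pdagger (pdagger p)"
    unfolding g_def by (rule pdagger_dvd_pdagger; simp)+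
  then have "pdagger g dvd g" by (simp add: g_def)
  then obtain c where c: "c \<noteq> 0" "g = smult c (pdagger g)"
    using same_degree_dvd_smult[of "pdagger g" g] g0 by auto
  have "g = smult c (pdagger (smult c (pdagger g)))" using c by simp
  then have "smult (c * cnj c - 1) g = 0" by (simp add: pdagger_smult smult_diff_left)
  then have "c * cnj c = 1" using g0 by simp
  then have "complex_of_real ((norm c)\<^sup>2) = complex_of_real 1"
    by (simp only: complex_norm_square of_real_1)
  then have "(norm c)\<^sup>2 = 1" by (simp only: of_real_eq_iff)
  then have nc: "norm c = 1" using norm_ge_zero[of c] by (auto simp: power2_eq_1_iff)
  define e where "e = csqrt c"
  have e2: "e * e = c" by (simp add: e_def flip: power2_eq_square)
  have "norm e = 1" using nc by (simp add: e_def)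
  then have ee: "e * cnj e = 1" by (simp add: complex_norm_square [symmetric])
  have e0: "e \<noteq> 0" using ee by auto
  define d where "d = smult (cnj e) g"
  have "pdagger d = smult e (pdagger g)" by (simp add: d_def pdagger_smult)
  also have "smult e (pdagger g) = smult (cnj e * (e * e)) (pdagger g)"
    using ee by (metis mult.assoc mult.commute mult_1)
  also have "smult (cnj e * (e * e)) (pdagger g) = smult (cnj e) (smult c (pdagger g))" by (simp add: e2)
  also have "\<dots> = d" using c(2) by (simp add: d_def)
  finally have dd: "pdagger d = d" .
  have d0: "d \<noteq> 0" using g0 e0 by (simp add: d_def)
  have "d dvd p" using e0 by (simp add: d_def g_def smult_dvd_iff)
  then obtain p0 where p0: "p = p0 * d" by (metis dvdE mult.commute)
  have "coprime p0 (pdagger p0)"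
  proof (rule coprimeI)
    fix k assume "k dvd p0" "k dvd pdagger p0"
    then have "k * d dvd p" "k * d dvd pdagger p"
      by (simp_all add: p0 pdagger_mult dd)
    then have "k * d dvd g" by (simp add: g_def)
    then have "k * d dvd smult (cnj e) g" using dvd_smult by blast
    then have "k * d dvd 1 * d" unfolding d_def by simp
    then show "is_unit k" using d0 by (simp only: dvd_mult_cancel_right) simp
  qed
  with p0 d0 dd show ?thesis using that by blast
qed

lemma Fract_reduce:
  assumes "p = p0 * d" "d \<noteq> 0" "pdagger d = d" "p0 \<noteq> 0"
  shows "Fraction_Field.Fract (pdagger p) p = Fraction_Field.Fract (pdagger p0) p0"
  using assms by (simp add: eq_fract pdagger_mult)

lemma unitary_rat_coprime:
  "unitary_rat n = {Fraction_Field.Fract (pdagger p) p | p. degree p \<le> n \<and> coprime p (pdagger p)}"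
proof (intro equalityI subsetI)
  fix r assume "r \<in> unitary_rat n"
  then obtain p where p: "r = Fraction_Field.Fract (pdagger p) p" "degree p \<le> n" "p \<noteq> 0"
    by (auto simp: unitary_rat_def)
  obtain p0 d where d: "p = p0 * d" "d \<noteq> 0" "pdagger d = d" "coprime p0 (pdagger p0)"
    using pdagger_reduce[OF p(3)] .
  have "degree p0 \<le> n" using p d by (auto simp: degree_mult_eq)
  with d p show "r \<in> {Fraction_Field.Fract (pdagger p) p | p. degree p \<le> n \<and> coprime p (pdagger p)}"
    using Fract_reduce coprime_pdagger_nonzero by blast
qed (use coprime_pdagger_nonzero in \<open>auto simp: unitary_rat_def\<close>)

lemma rat_num_den_Fract:
  assumes "coprime p (pdagger p)"
  defines "r \<equiv> Fraction_Field.Fract (pdagger p) p"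
  obtains c where "c \<noteq> 0" "pdagger p = smult c (rat_num r)" "p = smult c (rat_den r)"
proof -
  have p0: "p \<noteq> 0" using assms by auto
  have q: "quot_of_fract r = normalize_quot (pdagger p, p)"
    using quot_of_fract_quot_to_fract[of "(pdagger p, p)"] by (simp add: quot_to_fract_def r_def)
  obtain d where d: "pdagger p = rat_num r * d" "p = rat_den r * d"
    using normalize_quotE[OF p0, of "pdagger p"] unfolding rat_num_def rat_den_def q by metis
  have "d dvd p" "d dvd pdagger p" by (metis d dvd_triv_right)+
  then have "is_unit d" using assms(1) coprime_common_divisor by blast
  then obtain c where "d = [:c:]" "c \<noteq> 0"
    by (metis is_unit_poly_iff not_is_unit_0)
  with d that[of c] show ?thesis by simp
qed

lemma rat_eval_Fract:
  assumes "coprime p (pdagger p)"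
  shows "rat_eval (Fraction_Field.Fract (pdagger p) p) (\<i> * complex_of_real x)
     = cnj (poly p (\<i> * complex_of_real x)) / poly p (\<i> * complex_of_real x)"
proof -
  define r where "r = Fraction_Field.Fract (pdagger p) p"
  obtain c where c: "c \<noteq> 0" "pdagger p = smult c (rat_num r)" "p = smult c (rat_den r)"
    using rat_num_den_Fract[OF assms] unfolding r_def .
  have "cnj (poly p (\<i> * complex_of_real x)) = c * poly (rat_num r) (\<i> * complex_of_real x)"
    by (metis c(2) poly_pdagger_imag poly_smult)
  moreover have "poly p (\<i> * complex_of_real x) = c * poly (rat_den r) (\<i> * complex_of_real x)"
    by (metis c(3) poly_smult)
  ultimately show ?thesis using c(1) by (simp add: rat_eval_def r_def [symmetric])
qed

section \<open>The twisted polynomial and the approximation error\<close>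

text \<open>Splitting the rotation by \<open>\<omega> x\<close> evenly between numerator and denominator of
\<open>cnj (p (\<i> x)) / p (\<i> x)\<close> turns the phase error into \<open>- 2\<close> times the argument of a function that
is linear in \<open>p\<close>.\<close>

definition twist :: "real \<Rightarrow> complex poly \<Rightarrow> real \<Rightarrow> complex" where
  "twist \<omega> p x = poly p (\<i> * complex_of_real x) * cis (\<omega> * x / 2)"

text \<open>A bound \<open>M\<close> for the tangent of the argument of the twist. Without the division the
condition is closed under limits, invariant under real factors and meaningful at zeros of \<open>p\<close>.\<close>

definition tan_bounded :: "real \<Rightarrow> real \<Rightarrow> complex poly \<Rightarrow> bool" where
  "tan_bounded \<omega> M p \<longleftrightarrow> (\<forall>x\<in>{-1..1}. \<bar>Im (twist \<omega> p x)\<bar> \<le> M * \<bar>Re (twist \<omega> p x)\<bar>)"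

lemma continuous_on_twist [continuous_intros]:
  assumes "continuous_on S f" "continuous_on S g"
  shows "continuous_on S (\<lambda>x. twist (f x) p (g x))"
  unfolding twist_def cis_conv_exp
  by (intro continuous_intros assms) auto

lemma twist_eq_0_iff: "twist \<omega> p x = 0 \<longleftrightarrow> poly p (\<i> * complex_of_real x) = 0"
  by (simp add: twist_def)

lemma twist_add: "twist \<omega> (p + q) x = twist \<omega> p x + twist \<omega> q x"
  by (simp add: twist_def ring_distribs)

lemma twist_smult: "twist \<omega> (smult c p) x = c * twist \<omega> p x"
  by (simp add: twist_def)

text \<open>The rotations cancel: comparing two arguments of twists is a question about a
polynomial.\<close>

lemma Im_twist_mult_cnj:
  "Im (twist \<omega> p x * cnj (twist \<omega> q x)) = Im (poly (p * pdagger q) (\<i> * complex_of_real x))"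
proof -
  have "twist \<omega> p x * cnj (twist \<omega> q x) = poly (p * pdagger q) (\<i> * complex_of_real x)
      * (cis (\<omega> * x / 2) * cnj (cis (\<omega> * x / 2)))"
    by (simp add: twist_def)
  also have "cis (\<omega> * x / 2) * cnj (cis (\<omega> * x / 2)) = 1"
    by (simp add: cis_cnj cis_mult)
  finally show ?thesis by simp
qed

lemma rat_eval_eq_twist:
  assumes "coprime p (pdagger p)"
  shows "rat_eval (Fraction_Field.Fract (pdagger p) p) (\<i> * complex_of_real x)
     = cnj (twist \<omega> p x) / twist \<omega> p x * cis (\<omega> * x)"
proof -
  have "cis (\<omega> * x) = cis (\<omega> * x / 2) * cis (\<omega> * x / 2)"
    by (simp add: cis_mult)
  moreover have "cis (- (\<omega> * x / 2)) * cis (\<omega> * x / 2) = 1"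
    by (simp add: cis_mult)
  ultimately show ?thesis
    using coprime_pdagger_no_imaginary_root[OF assms, of x]
    by (simp add: rat_eval_Fract[OF assms] twist_def cis_cnj field_simps)
qed

lemma pointwise_error:
  assumes "coprime p (pdagger p)"
  shows "norm (rat_eval (Fraction_Field.Fract (pdagger p) p) (\<i> * complex_of_real x)
      - exp (\<i> * complex_of_real (\<omega> * x))) = 2 * \<bar>Im (twist \<omega> p x)\<bar> / norm (twist \<omega> p x)"
proof -
  have w: "twist \<omega> p x \<noteq> 0"
    using coprime_pdagger_no_imaginary_root[OF assms] by (simp add: twist_eq_0_iff)
  have "rat_eval (Fraction_Field.Fract (pdagger p) p) (\<i> * complex_of_real x)
      - exp (\<i> * complex_of_real (\<omega> * x))
    = (cnj (twist \<omega> p x) - twist \<omega> p x) / twist \<omega> p x * cis (\<omega> * x)"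
    using w by (simp add: rat_eval_eq_twist[OF assms, of _ \<omega>] cis_conv_exp field_simps)
  also have "cnj (twist \<omega> p x) - twist \<omega> p x = - \<i> * complex_of_real (2 * Im (twist \<omega> p x))"
    by (simp add: complex_eq_iff)
  finally show ?thesis by (simp add: norm_mult norm_divide abs_mult)
qed

lemma max_norm_le_iff:
  fixes f :: "real \<Rightarrow> 'a::real_normed_vector"
  assumes "continuous_on {-1..1} f"
  shows "max_norm f \<le> E \<longleftrightarrow> (\<forall>x\<in>{-1..1}. norm (f x) \<le> E)"
proof -
  have "compact ((\<lambda>x. norm (f x)) ` {-1..1})"
    by (intro compact_continuous_image continuous_intros assms) auto
  then have "bdd_above ((\<lambda>x. norm (f x)) ` {-1..1})"
    by (simp add: bounded_imp_bdd_above compact_imp_bounded)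
  then show ?thesis unfolding max_norm_def by (intro cSUP_le_iff) auto
qed

lemma max_norm_attained:
  fixes f :: "real \<Rightarrow> 'a::real_normed_vector"
  assumes "continuous_on {-1..1} f"
  obtains x where "x \<in> {-1..1}" "norm (f x) = max_norm f"
proof -
  have "\<exists>x\<in>{-1..1::real}. \<forall>y\<in>{-1..1}. norm (f y) \<le> norm (f x)"
    by (rule continuous_attains_sup) (auto intro!: continuous_intros assms)
  then obtain x where x: "x \<in> {-1..1}" "\<forall>y\<in>{-1..1}. norm (f y) \<le> norm (f x)" by blast
  then have "max_norm f = norm (f x)"
    using max_norm_le_iff[OF assms] by (metis antisym order_refl)
  with x(1) that show ?thesis by simp
qed

lemma approx_error_le_iff:
  assumes "coprime p (pdagger p)"
  shows "approx_error \<omega> (Fraction_Field.Fract (pdagger p) p) \<le> E \<longleftrightarrow>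
     (\<forall>x\<in>{-1..1}. 2 * \<bar>Im (twist \<omega> p x)\<bar> \<le> E * norm (twist \<omega> p x))"
proof -
  have w: "twist \<omega> p x \<noteq> 0" for x
    using coprime_pdagger_no_imaginary_root[OF assms] by (simp add: twist_eq_0_iff)
  have "continuous_on {-1..1} (\<lambda>x. rat_eval (Fraction_Field.Fract (pdagger p) p) (\<i> * complex_of_real x)
      - exp (\<i> * complex_of_real (\<omega> * x)))"
    unfolding rat_eval_eq_twist[OF assms, of _ \<omega>] cis_conv_exp
    by (intro continuous_intros) (use w in auto)
  then show ?thesis
    unfolding approx_error_def
    by (simp add: max_norm_le_iff pointwise_error[OF assms] w divide_le_eq del: of_real_mult)
qed

text \<open>The pointwise error is \<open>\<bar>cnj w / w - 1\<bar> = 2 \<bar>sin (arg w)\<bar>\<close>, and the sine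
belonging to the tangent \<open>M\<close> is \<open>M / sqrt (1 + M\<^sup>2)\<close>.\<close>

lemma approx_error_le_tan_bounded:
  assumes "coprime p (pdagger p)" "M \<ge> 0"
  shows "approx_error \<omega> (Fraction_Field.Fract (pdagger p) p) \<le> 2 * M / sqrt (1 + M\<^sup>2) \<longleftrightarrow> tan_bounded \<omega> M p"
proof -
  have "2 * \<bar>Im w\<bar> \<le> 2 * M / sqrt (1 + M\<^sup>2) * norm w \<longleftrightarrow> \<bar>Im w\<bar> \<le> M * \<bar>Re w\<bar>" for w
  proof -
    have s: "sqrt (1 + M\<^sup>2) > 0" by (simp add: add_pos_nonneg)
    have "2 * \<bar>Im w\<bar> \<le> 2 * M / sqrt (1 + M\<^sup>2) * norm w \<longleftrightarrow> \<bar>Im w\<bar> * sqrt (1 + M\<^sup>2) \<le> M * norm w"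
      using s by (simp add: field_simps)
    also have "\<dots> \<longleftrightarrow> (\<bar>Im w\<bar> * sqrt (1 + M\<^sup>2))\<^sup>2 \<le> (M * norm w)\<^sup>2"
      using assms(2) by (intro power_mono_iff [symmetric]) auto
    also have "\<dots> \<longleftrightarrow> \<bar>Im w\<bar>\<^sup>2 \<le> (M * \<bar>Re w\<bar>)\<^sup>2"
      by (simp add: power_mult_distrib cmod_power2 algebra_simps)
    also have "\<dots> \<longleftrightarrow> \<bar>Im w\<bar> \<le> M * \<bar>Re w\<bar>"
      using assms(2) by (intro power_mono_iff) auto
    finally show ?thesis .
  qed
  then show ?thesis unfolding approx_error_le_iff[OF assms(1)] tan_bounded_def by simp
qed

lemma approx_error_nonneg:
  assumes "coprime p (pdagger p)"
  shows "0 \<le> approx_error \<omega> (Fraction_Field.Fract (pdagger p) p)"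
proof -
  have "2 * \<bar>Im (twist \<omega> p 0)\<bar> \<le> approx_error \<omega> (Fraction_Field.Fract (pdagger p) p) * norm (twist \<omega> p 0)"
    using approx_error_le_iff[OF assms, of \<omega> "approx_error \<omega> (Fraction_Field.Fract (pdagger p) p)"] by auto
  moreover have "norm (twist \<omega> p 0) > 0"
    using coprime_pdagger_no_imaginary_root[OF assms, of 0] by (simp add: twist_eq_0_iff)
  moreover have "0 \<le> 2 * \<bar>Im (twist \<omega> p 0)\<bar>" by simp
  ultimately show ?thesis
    by (meson mult_neg_pos not_le order_trans)
qed

section \<open>Perturbation and compactness\<close>

text \<open>If the conclusion failed for \<open>t = 1, 1/2, 1/3, \<dots>\<close>, the offending points would accumulate
at a zero of \<open>h0\<close>, while dividing the failed inequality by \<open>t\<close> shows \<open>h1 \<ge> 0\<close> there.\<close>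

lemma first_order_decrease:
  fixes h0 h1 h2 :: "real \<Rightarrow> real"
  assumes "compact K" "continuous_on K h0" "continuous_on K h1" "continuous_on K h2"
    and neg: "\<And>x. x \<in> K \<Longrightarrow> h0 x \<le> 0" "\<And>x. x \<in> K \<Longrightarrow> h0 x = 0 \<Longrightarrow> h1 x < 0"
  shows "\<exists>t>0. \<forall>x\<in>K. h0 x + t * h1 x + t\<^sup>2 * h2 x < 0"
proof (rule ccontr)
  assume "\<not> ?thesis"
  then have "\<exists>x\<in>K. h0 x + t * h1 x + t\<^sup>2 * h2 x \<ge> 0" if "t > 0" for t
    using that by (meson not_le)
  from this[of "1 / (real _ + 1)"]
  have "\<exists>x\<in>K. h0 x + (1 / (real k + 1)) * h1 x + (1 / (real k + 1))\<^sup>2 * h2 x \<ge> 0" for k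
    by simp
  then obtain x where x: "\<And>k. x k \<in> K"
    and ge: "\<And>k. h0 (x k) + (1 / (real k + 1)) * h1 (x k) + (1 / (real k + 1))\<^sup>2 * h2 (x k) \<ge> 0"
    by metis
  obtain l s where l: "l \<in> K" "strict_mono s" "(x \<circ> s) \<longlonglongrightarrow> l"
    using assms(1) x by (metis compact_imp_seq_compact seq_compactE)
  have lim: "(\<lambda>k. h (x (s k))) \<longlonglongrightarrow> h l" if "continuous_on K h" for h :: "real \<Rightarrow> real"
    using continuous_on_tendsto_compose[OF that l(3) l(1)] x by (auto simp: o_def)
  have t0: "(\<lambda>k. 1 / (real (s k) + 1)) \<longlonglongrightarrow> 0"
    using LIMSEQ_subseq_LIMSEQ[OF LIMSEQ_inverse_real_of_nat l(2)] by (simp add: o_def inverse_eq_divide add.commute)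
  have "(\<lambda>k. h0 (x (s k)) + 1 / (real (s k) + 1) * h1 (x (s k)) + (1 / (real (s k) + 1))\<^sup>2 * h2 (x (s k)))
      \<longlonglongrightarrow> h0 l + 0 * h1 l + 0\<^sup>2 * h2 l"
    by (intro tendsto_intros lim t0 assms)
  then have "h0 l \<ge> 0" using ge by (intro LIMSEQ_le_const) (auto intro!: exI[of _ 0])
  then have "h1 l < 0" using neg l(1) by (metis order_antisym)
  moreover have "h1 l \<ge> 0"
  proof -
    have "h1 (x k) + 1 / (real k + 1) * h2 (x k) \<ge> 0" for k
    proof -
      have "(1 / (real k + 1)) * (h1 (x k) + 1 / (real k + 1) * h2 (x k)) \<ge> 0"
        using ge[of k] neg(1)[OF x, of k] by (simp add: power2_eq_square ring_distribs)
      then show ?thesis by (simp add: zero_le_divide_iff)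
    qed
    moreover have "(\<lambda>k. h1 (x (s k)) + 1 / (real (s k) + 1) * h2 (x (s k))) \<longlonglongrightarrow> h1 l + 0 * h2 l"
      by (intro tendsto_intros lim t0 assms)
    ultimately show ?thesis by (intro LIMSEQ_le_const[of _ "h1 l"]) auto
  qed
  ultimately show False by simp
qed

lemma coordinatewise_subseq:
  fixes a :: "nat \<Rightarrow> nat \<Rightarrow> 'b::metric_space"
  assumes "compact K" "\<And>k i. a k i \<in> K"
  shows "\<exists>(l :: nat \<Rightarrow> 'b) (s :: nat \<Rightarrow> nat). strict_mono s \<and> (\<forall>i. l i \<in> K \<and> (\<lambda>k. a (s k) i) \<longlonglongrightarrow> l i)"
proof -
  have "compact (PiE UNIV (\<lambda>_::nat. K))"
    using compactin_PiE[of "\<lambda>_::nat. euclidean :: 'b topology" UNIV "\<lambda>_. K"] assms(1)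
    by (simp add: euclidean_product_topology)
  moreover have "a k \<in> PiE UNIV (\<lambda>_. K)" for k using assms(2) by (simp add: PiE_UNIV_domain)
  ultimately obtain l s where s: "strict_mono s" and l: "l \<in> PiE UNIV (\<lambda>_. K)" and al: "(a \<circ> s) \<longlonglongrightarrow> l"
    by (metis compact_imp_seq_compact seq_compactE)
  have "(\<lambda>k. a (s k) i) \<longlonglongrightarrow> l i" for i
    using continuous_on_tendsto_compose[OF continuous_on_product_coordinates[of i] al]
    by (simp add: o_def)
  moreover have "l i \<in> K" for i using l by auto
  ultimately show ?thesis using s by blast
qed

text \<open>Scaling the coefficient vectors to \<open>\<ell>\<^sup>1\<close> norm one makes a subsequence converge to a nonzero
vector. The scaling factors are positive reals, so that signs of real and imaginary parts of
values survive. Convergence is continuous convergence, along moving arguments.\<close>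

lemma poly_sequence_compact:
  fixes p :: "nat \<Rightarrow> complex poly"
  assumes deg: "\<And>k. degree (p k) \<le> n" and nz: "\<And>k. p k \<noteq> 0"
  shows "\<exists>(s :: nat \<Rightarrow> nat) (c :: nat \<Rightarrow> real) q. strict_mono s \<and> (\<forall>k. c k > 0) \<and> q \<noteq> 0 \<and> degree q \<le> n \<and>
    (\<forall>z l. z \<longlonglongrightarrow> l \<longrightarrow> (\<lambda>k. complex_of_real (c k) * poly (p (s k)) (z k)) \<longlonglongrightarrow> poly q l)"
proof -
  define N where "N k = (\<Sum>i\<le>n. cmod (coeff (p k) i))" for k
  have Npos: "N k > 0" for k
  proof -
    have "cmod (lead_coeff (p k)) \<le> N k"
      unfolding N_def using deg by (intro member_le_sum) auto
    moreover have "cmod (lead_coeff (p k)) > 0" using nz by simp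
    ultimately show ?thesis by linarith
  qed
  define a where "a k i = complex_of_real (1 / N k) * coeff (p k) i" for k i
  have sum1: "(\<Sum>i\<le>n. cmod (a k i)) = 1" for k
  proof -
    have "(\<Sum>i\<le>n. cmod (a k i)) = (\<Sum>i\<le>n. cmod (coeff (p k) i)) / N k"
      using Npos[of k] by (simp add: a_def norm_mult norm_divide sum_divide_distrib)
    then show ?thesis using Npos[of k] by (simp add: N_def)
  qed
  have a1: "a k i \<in> cball 0 1" for k i
  proof (cases "i \<le> n")
    case True
    then have "cmod (a k i) \<le> (\<Sum>i\<le>n. cmod (a k i))"
      by (intro member_le_sum) auto
    then show ?thesis by (simp add: sum1)
  next
    case False
    then have "coeff (p k) i = 0" using deg[of k] by (intro coeff_eq_0) auto
    then show ?thesis by (simp add: a_def)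
  qed
  obtain l s where s: "strict_mono s" and lim: "\<And>i. (\<lambda>k. a (s k) i) \<longlonglongrightarrow> l i"
    using coordinatewise_subseq[of "cball 0 1" a, OF compact_cball a1] by blast
  define q where "q = (\<Sum>i\<le>n. monom (l i) i)"
  have q_coeff: "poly q z = (\<Sum>i\<le>n. l i * z ^ i)" for z
    by (simp add: q_def poly_sum poly_monom)
  \<comment> \<open>The normalisation passes to the limit, which is therefore not the zero vector.\<close>
  have "(\<lambda>k. \<Sum>i\<le>n. cmod (a (s k) i)) \<longlonglongrightarrow> (\<Sum>i\<le>n. cmod (l i))"
    by (intro tendsto_intros lim)
  then have "(\<Sum>i\<le>n. cmod (l i)) = 1" by (simp add: sum1 LIMSEQ_const_iff)
  then obtain i where i: "i \<le> n" "l i \<noteq> 0" by (metis (no_types, lifting) atMost_iff norm_zero sum.neutral zero_neq_one)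
  have "coeff q i = l i" using i(1) by (simp add: q_def coeff_sum)
  then have "q \<noteq> 0" using i(2) by auto
  moreover have "degree q \<le> n" unfolding q_def
    by (intro degree_sum_le) (auto intro: order_trans[OF degree_monom_le])
  moreover have "(\<lambda>k. complex_of_real (1 / N (s k)) * poly (p (s k)) (z k)) \<longlonglongrightarrow> poly q y" if "z \<longlonglongrightarrow> y" for z y
  proof -
    have "poly (p k) w = (\<Sum>i\<le>n. coeff (p k) i * w ^ i)" for k w
      unfolding poly_altdef using deg[of k]
      by (intro sum.mono_neutral_left) (auto intro: coeff_eq_0)
    then have "complex_of_real (1 / N (s k)) * poly (p (s k)) (z k) = (\<Sum>i\<le>n. a (s k) i * z k ^ i)" for k
      by (simp add: a_def sum_distrib_left mult.assoc)
    moreover have "(\<lambda>k. \<Sum>i\<le>n. a (s k) i * z k ^ i) \<longlonglongrightarrow> (\<Sum>i\<le>n. l i * y ^ i)"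
      by (intro tendsto_intros lim that)
    ultimately show ?thesis by (simp add: q_coeff)
  qed
  ultimately show ?thesis
    using s Npos by (intro exI[of _ s] exI[of _ "\<lambda>k. 1 / N (s k)"] exI[of _ q]) simp
qed


lemma twist_sequence_compact:
  fixes p :: "nat \<Rightarrow> complex poly" and \<Omega> :: "nat \<Rightarrow> real"
  assumes "\<And>k. degree (p k) \<le> n" "\<And>k. p k \<noteq> 0" "\<Omega> \<longlonglongrightarrow> \<omega>"
  shows "\<exists>(s :: nat \<Rightarrow> nat) (c :: nat \<Rightarrow> real) q. strict_mono s \<and> (\<forall>k. c k > 0) \<and> q \<noteq> 0 \<and> degree q \<le> n \<and>
    (\<forall>x l. x \<longlonglongrightarrow> l \<longrightarrow> (\<lambda>k. complex_of_real (c k) * twist (\<Omega> (s k)) (p (s k)) (x k)) \<longlonglongrightarrow> twist \<omega> q l)"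
proof -
  obtain s :: "nat \<Rightarrow> nat" and c :: "nat \<Rightarrow> real" and q where s: "strict_mono s" "\<And>k. c k > 0" "q \<noteq> 0" "degree q \<le> n"
    and lim: "\<And>z l. z \<longlonglongrightarrow> l \<Longrightarrow> (\<lambda>k. complex_of_real (c k) * poly (p (s k)) (z k)) \<longlonglongrightarrow> poly q l"
    using poly_sequence_compact[of p n, OF assms(1,2)] by blast
  have "(\<lambda>k. complex_of_real (c k) * twist (\<Omega> (s k)) (p (s k)) (x k)) \<longlonglongrightarrow> twist \<omega> q l" if "x \<longlonglongrightarrow> l" for x l
  proof -
    have "(\<lambda>k. \<Omega> (s k)) \<longlonglongrightarrow> \<omega>"
      using LIMSEQ_subseq_LIMSEQ[OF assms(3) s(1)] by (simp add: o_def)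
    then have "(\<lambda>k. cis (\<Omega> (s k) * x k / 2)) \<longlonglongrightarrow> cis (\<omega> * l / 2)"
      unfolding cis_conv_exp using that by (intro tendsto_intros) auto
    moreover have "(\<lambda>k. complex_of_real (c k) * poly (p (s k)) (\<i> * complex_of_real (x k)))
        \<longlonglongrightarrow> poly q (\<i> * complex_of_real l)"
      using that by (intro lim tendsto_intros)
    ultimately have "(\<lambda>k. complex_of_real (c k) * poly (p (s k)) (\<i> * complex_of_real (x k))
        * cis (\<Omega> (s k) * x k / 2)) \<longlonglongrightarrow> poly q (\<i> * complex_of_real l) * cis (\<omega> * l / 2)"
      by (intro tendsto_mult)
    then show ?thesis unfolding twist_def mult.assoc .
  qed
  with s show ?thesis by blast
qed

section \<open>A polynomial whose twist has positive real part\<close>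

text \<open>In the variable \<open>u = \<omega> x / 2 + (n + 1) \<pi> / 2\<close> the interval \<open>[-1,1]\<close> becomes a subinterval of
\<open>(0, (n + 1) \<pi>)\<close>, which contains exactly \<open>n\<close> zeros of the sine.\<close>

definition node_poly :: "nat \<Rightarrow> real poly" where
  "node_poly n = (\<Prod>k=1..n. [:- (real k * pi), 1:])"

lemma node_poly_Suc: "node_poly (Suc n) = node_poly n * [:- (real (Suc n) * pi), 1:]"
  by (simp add: node_poly_def mult.commute)

lemma degree_node_poly: "degree (node_poly n) \<le> n"
proof (induction n)
  case 0
  then show ?case by (simp add: node_poly_def)
next
  case (Suc n)
  have "degree (node_poly (Suc n)) \<le> degree (node_poly n) + degree [:- (real (Suc n) * pi), 1:]"
    unfolding node_poly_Suc by (rule degree_mult_le)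
  with Suc show ?case by simp
qed

lemma node_poly_root: "k \<in> {1..n} \<Longrightarrow> poly (node_poly n) (real k * pi) = 0"
  by (force simp: node_poly_def poly_prod)

lemma node_poly_pos: "u > real n * pi \<Longrightarrow> poly (node_poly n) u > 0"
  unfolding node_poly_def poly_prod
proof (rule prod_pos)
  fix k assume "u > real n * pi" "k \<in> {1..n}"
  have "real k * pi \<le> real n * pi" using \<open>k \<in> {1..n}\<close> by simp
  also note \<open>real n * pi < u\<close>
  finally show "0 < poly [:- (real k * pi), 1:] u" by simp
qed

lemma sin_minus_multiple_pi: "sin (u - real n * pi) = (-1) ^ n * sin u"
  by (simp add: sin_diff)

text \<open>Sine and node polynomial change sign at the same points.\<close>

lemma node_poly_sin_nonneg:
  assumes "0 < u" "u < (real n + 1) * pi"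
  shows "(-1) ^ n * poly (node_poly n) u * sin u \<ge> 0 \<and>
    ((-1) ^ n * poly (node_poly n) u * sin u = 0 \<longrightarrow> (\<exists>k\<in>{1..n}. u = real k * pi))"
  using assms(2)
proof (induction n)
  case 0
  then have "sin u > 0" using assms(1) by (intro sin_gt_zero) auto
  then show ?case by (simp add: node_poly_def)
next
  case (Suc n)
  define N where "N = real (Suc n) * pi"
  have eq: "(-1) ^ Suc n * poly (node_poly (Suc n)) u * sin u
      = ((-1) ^ n * poly (node_poly n) u * sin u) * (N - u)"
    by (simp add: node_poly_Suc N_def algebra_simps)
  consider "u < N" | "u = N" | "u > N" by linarith
  then show ?case
  proof cases
    case 1
    then have "0 \<le> (-1) ^ n * poly (node_poly n) u * sin u" 
      "(-1) ^ n * poly (node_poly n) u * sin u = 0 \<longrightarrow> (\<exists>k\<in>{1..n}. u = real k * pi)"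
      using Suc.IH by (simp_all add: N_def add.commute)
    then show ?thesis unfolding eq using 1 by (auto simp: zero_le_mult_iff)
  next
    case 2
    then have "u = real (Suc n) * pi" by (simp add: N_def)
    then show ?thesis unfolding eq using 2 by (auto intro!: bexI[of _ "Suc n"])
  next
    case 3
    have "poly (node_poly (Suc n)) u > 0" using 3 unfolding N_def by (rule node_poly_pos)
    moreover have "sin (u - real (Suc n) * pi) > 0"
      using 3 Suc.prems by (intro sin_gt_zero) (auto simp: N_def algebra_simps)
    ultimately have "poly (node_poly (Suc n)) u * ((-1) ^ Suc n * sin u) > 0"
      unfolding sin_minus_multiple_pi by (rule mult_pos_pos)
    then have "(-1) ^ Suc n * poly (node_poly (Suc n)) u * sin u > 0" by (simp only: mult_ac)
    then show ?thesis by (metis less_imp_le less_irrefl)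
  qed
qed

text \<open>The expression is half the second derivative of \<open>(-1) ^ n * node_poly n u * sin u\<close> at its
double zero \<open>k \<pi>\<close>.\<close>

lemma pderiv_node_poly_sign:
  assumes "k \<in> {1..n}"
  shows "(-1) ^ n * poly (pderiv (node_poly n)) (real k * pi) * cos (real k * pi) > 0"
  using assms
proof (induction n)
  case (Suc n)
  have "pderiv (node_poly (Suc n)) = node_poly n + [:- (real (Suc n) * pi), 1:] * pderiv (node_poly n)"
    unfolding node_poly_Suc pderiv_mult by (simp add: pderiv_pCons)
  then have eq: "poly (pderiv (node_poly (Suc n))) u
      = poly (node_poly n) u + (u - real (Suc n) * pi) * poly (pderiv (node_poly n)) u" for u
    by (simp add: algebra_simps)
  show ?case
  proof (cases "k = Suc n")
    case True
    have "poly (node_poly n) (real k * pi) > 0" by (rule node_poly_pos) (simp add: True)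
    moreover have "(-1::real) ^ Suc n * (-1) ^ Suc n = 1" by (simp flip: power_mult_distrib)
    ultimately show ?thesis
      unfolding eq cos_npi using True by (simp add: mult.commute mult.left_commute)
  next
    case False
    then have k: "k \<in> {1..n}" using Suc.prems by auto
    have "(-1) ^ Suc n * poly (pderiv (node_poly (Suc n))) (real k * pi) * cos (real k * pi)
      = (real (Suc n) * pi - real k * pi) * ((-1) ^ n * poly (pderiv (node_poly n)) (real k * pi) * cos (real k * pi))"
      unfolding eq node_poly_root[OF k] by (simp add: algebra_simps)
    moreover have "real (Suc n) * pi - real k * pi > 0" using k by simp
    ultimately show ?thesis using Suc.IH[OF k] by simp
  qed
qed simp

lemma poly_of_real: "poly (map_poly complex_of_real p) (complex_of_real x) = complex_of_real (poly p x)"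
  by (induction p) (simp_all add: map_poly_pCons)

text \<open>With \<open>P\<close> the node polynomial, \<open>(P + \<i> t P') * exp (\<i> u)\<close> has imaginary part
\<open>P sin u + t P' cos u\<close>. The first term has constant sign and vanishes only at the nodes, where
the second one has that same sign, so a small \<open>t > 0\<close> makes the sum nonzero everywhere.\<close>

lemma exists_positive_twist:
  assumes "0 < \<omega>" "\<omega> < (real n + 1) * pi"
  obtains p where "degree p \<le> n" "\<And>x. x \<in> {-1..1} \<Longrightarrow> Re (twist \<omega> p x) > 0"
proof -
  define P where "P = node_poly n"
  define u where "u x = \<omega> * x / 2 + (real n + 1) * pi / 2" for x
  have u: "0 < u x" "u x < (real n + 1) * pi" if "x \<in> {-1..1}" for x
  proof -
    have "\<bar>\<omega> * x\<bar> \<le> \<omega> * 1" using assms(1) that by (simp add: abs_mult abs_le_iff)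
    then show "0 < u x" "u x < (real n + 1) * pi" using assms by (auto simp: u_def)
  qed
  have cu: "continuous_on S u" for S unfolding u_def by (intro continuous_intros) auto
  have "\<exists>t>0. \<forall>x\<in>{-1..1}. - ((-1) ^ n * poly P (u x) * sin (u x))
      + t * - ((-1) ^ n * poly (pderiv P) (u x) * cos (u x)) + t\<^sup>2 * 0 < 0"
  proof (rule first_order_decrease)
    fix x :: real assume x: "x \<in> {-1..1}"
    show "- ((-1) ^ n * poly P (u x) * sin (u x)) \<le> 0"
      using node_poly_sin_nonneg[OF u[OF x]] by (simp add: P_def)
    assume "- ((-1) ^ n * poly P (u x) * sin (u x)) = 0"
    then have "(-1) ^ n * poly (node_poly n) (u x) * sin (u x) = 0" unfolding P_def by linarith
    then obtain k where k: "k \<in> {1..n}" "u x = real k * pi"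
      using node_poly_sin_nonneg[OF u[OF x]] by auto
    show "- ((-1) ^ n * poly (pderiv P) (u x) * cos (u x)) < 0"
      using pderiv_node_poly_sign[OF k(1)] unfolding k(2) P_def by simp
  qed (auto intro!: continuous_intros cu)
  then obtain t where t: "\<And>x. x \<in> {-1..1} \<Longrightarrow>
      - ((-1) ^ n * poly P (u x) * sin (u x))
      + t * - ((-1) ^ n * poly (pderiv P) (u x) * cos (u x)) + t\<^sup>2 * 0 < 0"
    by blast
  define Q where "Q = map_poly complex_of_real P + smult (\<i> * t) (map_poly complex_of_real (pderiv P))"
  define p where "p = smult (- \<i> * (-1) ^ n * cis ((real n + 1) * pi / 2)) (Q \<circ>\<^sub>p [:(real n + 1) * pi / 2, - \<i> * \<omega> / 2:])"
  have "degree (map_poly complex_of_real r) = degree r" for r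
    by (simp add: degree_map_poly)
  then have "degree Q \<le> n" unfolding Q_def using degree_node_poly[of n]
    by (intro degree_add_le order_trans[OF degree_smult_le]) (simp_all add: P_def degree_pderiv)
  then have deg: "degree p \<le> n" using assms(1) by (simp add: p_def degree_pcompose)
  have "Re (twist \<omega> p x) > 0" if "x \<in> {-1..1}" for x
  proof -
    have "poly [:(real n + 1) * pi / 2, - \<i> * \<omega> / 2:] (\<i> * complex_of_real x) = complex_of_real (u x)"
      by (simp add: u_def field_simps)
    then have "poly p (\<i> * complex_of_real x) = - \<i> * (-1) ^ n * cis ((real n + 1) * pi / 2)
        * (poly P (u x) + \<i> * t * poly (pderiv P) (u x))"
      by (simp add: p_def poly_pcompose Q_def poly_of_real)
    then have "twist \<omega> p x = - \<i> * (-1) ^ n * (poly P (u x) + \<i> * t * poly (pderiv P) (u x))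
        * (cis ((real n + 1) * pi / 2) * cis (\<omega> * x / 2))"
      by (simp add: twist_def)
    also have "cis ((real n + 1) * pi / 2) * cis (\<omega> * x / 2) = cis (u x)"
      by (simp add: cis_mult u_def add.commute)
    also have "(-1) ^ n = complex_of_real ((-1) ^ n)" by simp
    finally have w: "twist \<omega> p x = - \<i> * complex_of_real ((-1) ^ n)
        * (poly P (u x) + \<i> * t * poly (pderiv P) (u x)) * cis (u x)" .
    have "Re (- \<i> * complex_of_real a * (complex_of_real b + \<i> * t * complex_of_real c) * cis v)
        = - (- (a * b * sin v) + t * - (a * c * cos v) + t\<^sup>2 * 0)" for a b c v
      by (simp add: algebra_simps)
    then have "Re (twist \<omega> p x) = - (- ((-1) ^ n * poly P (u x) * sin (u x))
      + t * - ((-1) ^ n * poly (pderiv P) (u x) * cos (u x)) + t\<^sup>2 * 0)"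
      unfolding w .
    then show ?thesis using t[OF that] by simp
  qed
  with deg show ?thesis using that by blast
qed

section \<open>The minimal tangent and its minimisers\<close>

lemma twist_mult_real:
  assumes "pdagger d = d"
  shows "twist \<omega> (p * d) x = complex_of_real (Re (poly d (\<i> * complex_of_real x))) * twist \<omega> p x"
proof -
  have "cnj (poly d (\<i> * complex_of_real x)) = poly d (\<i> * complex_of_real x)"
    by (metis assms poly_pdagger_imag)
  then have "poly d (\<i> * complex_of_real x) = complex_of_real (Re (poly d (\<i> * complex_of_real x)))"
    by (simp add: complex_eq_iff)
  then show ?thesis by (simp add: twist_def)
qed

text \<open>Off the finitely many zeros of \<open>d\<close> the real factor cancels; by continuity the bound extends to
these zeros. Minimisers may thus be taken coprime to their reflection.\<close>

lemma tan_bounded_reduce: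
  assumes "tan_bounded \<omega> M (p * d)" "d \<noteq> 0" "pdagger d = d"
  shows "tan_bounded \<omega> M p"
  unfolding tan_bounded_def
proof (rule ballI, rule ccontr)
  define F where "F x = \<bar>Im (twist \<omega> p x)\<bar> - M * \<bar>Re (twist \<omega> p x)\<bar>" for x
  fix x assume x: "x \<in> {-1..1::real}" and "\<not> \<bar>Im (twist \<omega> p x)\<bar> \<le> M * \<bar>Re (twist \<omega> p x)\<bar>"
  then have Fx: "F x > 0" by (simp add: F_def)
  have "continuous_on {-1..1} F" unfolding F_def by (intro continuous_intros)
  then obtain \<delta> where \<delta>: "\<delta> > 0" "\<And>y. y \<in> {-1..1} \<Longrightarrow> dist y x < \<delta> \<Longrightarrow> dist (F y) (F x) < F x"
    using x Fx unfolding continuous_on_iff by blast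
  \<comment> \<open>The bound fails on a whole interval around \<open>x\<close>, where \<open>d\<close> then has to vanish.\<close>
  define S where "S = {max (-1) (x - \<delta>)<..<min 1 (x + \<delta>)}"
  have "infinite S" unfolding S_def using x \<delta>(1) by (intro infinite_Ioo) auto
  moreover have "poly d (\<i> * complex_of_real y) = poly 0 (\<i> * complex_of_real y)" if "y \<in> S" for y
  proof -
    have y: "y \<in> {-1..1}" "dist y x < \<delta>" using that by (auto simp: S_def dist_real_def)
    then have "F y > 0" using \<delta>(2)[OF y] by (simp add: dist_real_def abs_less_iff)
    define r where "r = Re (poly d (\<i> * complex_of_real y))"
    have "\<bar>r\<bar> * \<bar>Im (twist \<omega> p y)\<bar> \<le> M * (\<bar>r\<bar> * \<bar>Re (twist \<omega> p y)\<bar>)"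
      using assms(1) y(1) unfolding tan_bounded_def twist_mult_real[OF assms(3)]
      by (simp add: r_def abs_mult)
    then have "\<bar>r\<bar> * F y \<le> 0" by (simp add: F_def algebra_simps)
    then have "r = 0" using \<open>F y > 0\<close> by (auto simp: mult_le_0_iff)
    then show ?thesis
      using assms(3) poly_pdagger_imag[of d y] by (simp add: r_def complex_eq_iff)
  qed
  ultimately have "d = 0" by (rule poly_eq_on_imaginary_axis)
  with assms(2) show False by simp
qed

definition best_tan :: "nat \<Rightarrow> real \<Rightarrow> real" where
  "best_tan n \<omega> = Inf {M. M \<ge> 0 \<and> (\<exists>p. p \<noteq> 0 \<and> degree p \<le> n \<and> tan_bounded \<omega> M p)}"

lemma best_tan_le:
  assumes "M \<ge> 0" "p \<noteq> 0" "degree p \<le> n" "tan_bounded \<omega> M p"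
  shows "best_tan n \<omega> \<le> M"
  unfolding best_tan_def using assms by (intro cInf_lower) (auto intro: bdd_belowI[of _ 0])

lemma tan_bounded_limit:
  assumes lim: "\<And>x l. x \<longlonglongrightarrow> l \<Longrightarrow> (\<lambda>k. complex_of_real (c k) * twist (\<Omega> k) (p k) (x k)) \<longlonglongrightarrow> twist \<omega> q l"
    and "L \<longlonglongrightarrow> M" and "\<And>k. tan_bounded (\<Omega> k) (L k) (p k)"
  shows "tan_bounded \<omega> M q"
  unfolding tan_bounded_def
proof
  fix x assume x: "x \<in> {-1..1::real}"
  define w where "w k = complex_of_real (c k) * twist (\<Omega> k) (p k) x" for k
  have w: "w \<longlonglongrightarrow> twist \<omega> q x" unfolding w_def by (rule lim) simp
  have "\<bar>Im (w k)\<bar> \<le> L k * \<bar>Re (w k)\<bar>" for k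
  proof -
    have "\<bar>c k\<bar> * \<bar>Im (twist (\<Omega> k) (p k) x)\<bar> \<le> \<bar>c k\<bar> * (L k * \<bar>Re (twist (\<Omega> k) (p k) x)\<bar>)"
      using assms(3)[of k] x by (intro mult_left_mono) (auto simp: tan_bounded_def)
    then show ?thesis by (simp add: w_def abs_mult mult_ac)
  qed
  moreover have "(\<lambda>k. \<bar>Im (w k)\<bar>) \<longlonglongrightarrow> \<bar>Im (twist \<omega> q x)\<bar>" "(\<lambda>k. L k * \<bar>Re (w k)\<bar>) \<longlonglongrightarrow> M * \<bar>Re (twist \<omega> q x)\<bar>"
    by (intro tendsto_intros w assms(2))+
  ultimately show "\<bar>Im (twist \<omega> q x)\<bar> \<le> M * \<bar>Re (twist \<omega> q x)\<bar>"
    by (intro LIMSEQ_le) auto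
qed

definition slope :: "real \<Rightarrow> complex poly \<Rightarrow> real \<Rightarrow> real" where
  "slope \<omega> p x = Im (twist \<omega> p x) / Re (twist \<omega> p x)"

lemma continuous_on_slope:
  assumes "\<And>x. x \<in> S \<Longrightarrow> Re (twist \<omega> p x) \<noteq> 0"
  shows "continuous_on S (slope \<omega> p)"
  unfolding slope_def [abs_def] by (intro continuous_intros) (use assms in auto)

lemma tan_bounded_max_slope:
  assumes "\<And>x. x \<in> {-1..1} \<Longrightarrow> Re (twist \<omega> p x) \<noteq> 0"
  shows "tan_bounded \<omega> (max_norm (slope \<omega> p)) p"
  unfolding tan_bounded_def
proof
  fix x assume x: "x \<in> {-1..1::real}"
  then have "\<bar>slope \<omega> p x\<bar> \<le> max_norm (slope \<omega> p)"
    using max_norm_le_iff[OF continuous_on_slope[OF assms], of "max_norm (slope \<omega> p)"] by auto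
  then show "\<bar>Im (twist \<omega> p x)\<bar> \<le> max_norm (slope \<omega> p) * \<bar>Re (twist \<omega> p x)\<bar>"
    using assms[OF x] by (simp add: slope_def abs_divide divide_le_eq)
qed

text \<open>A minimising sequence of scaled polynomials has a nonzero limit, which satisfies the limiting
bound; the common factor with its reflection is then removed.\<close>

lemma best_tan_attained:
  assumes "0 < \<omega>" "\<omega> < (real n + 1) * pi"
  shows "best_tan n \<omega> \<ge> 0"
    and "\<exists>p. degree p \<le> n \<and> coprime p (pdagger p) \<and> tan_bounded \<omega> (best_tan n \<omega>) p"
proof -
  define A where "A = {M. M \<ge> 0 \<and> (\<exists>p. p \<noteq> 0 \<and> degree p \<le> n \<and> tan_bounded \<omega> M p)}"
  obtain p where p: "degree p \<le> n" "\<And>x. x \<in> {-1..1} \<Longrightarrow> Re (twist \<omega> p x) > 0"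
    using exists_positive_twist[OF assms] by blast
  have nz: "Re (twist \<omega> p x) \<noteq> 0" if "x \<in> {-1..1}" for x using p(2)[OF that] by simp
  have "tan_bounded \<omega> (max_norm (slope \<omega> p)) p" by (rule tan_bounded_max_slope[OF nz])
  moreover have "max_norm (slope \<omega> p) \<ge> 0"
    using max_norm_attained[OF continuous_on_slope[OF nz]] by (metis norm_ge_zero)
  moreover have "p \<noteq> 0" using p(2)[of 0] by (auto simp: twist_def)
  ultimately have ne: "A \<noteq> {}" using p(1) by (auto simp: A_def)
  have bdd: "bdd_below A" by (auto simp: A_def intro: bdd_belowI[of _ 0])
  show pos: "best_tan n \<omega> \<ge> 0" unfolding best_tan_def A_def [symmetric]
    using ne by (intro cInf_greatest) (auto simp: A_def)
  have "\<exists>M\<in>A. M < best_tan n \<omega> + 1 / (real k + 1)" for k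
    using ne bdd cInf_lessD[OF ne, of "best_tan n \<omega> + 1 / (real k + 1)"]
    by (auto simp: best_tan_def A_def [symmetric])
  then obtain M where M: "\<And>k. M k \<in> A" "\<And>k. M k < best_tan n \<omega> + 1 / (real k + 1)" by metis
  then obtain q where q: "\<And>k. q k \<noteq> 0" "\<And>k. degree (q k) \<le> n" "\<And>k. tan_bounded \<omega> (M k) (q k)"
    unfolding A_def by (auto simp: all_conj_distrib) metis
  have "(\<lambda>k. best_tan n \<omega> + 1 / (real k + 1)) \<longlonglongrightarrow> best_tan n \<omega> + 0"
    using LIMSEQ_inverse_real_of_nat by (intro tendsto_intros) (simp add: inverse_eq_divide add.commute)
  then have le: "(\<lambda>k. best_tan n \<omega> + 1 / (real k + 1)) \<longlonglongrightarrow> best_tan n \<omega>" by simp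
  have ge: "best_tan n \<omega> \<le> M k" for k
    unfolding best_tan_def A_def [symmetric] using M(1) bdd by (rule cInf_lower)
  have "M \<longlonglongrightarrow> best_tan n \<omega>"
    by (rule tendsto_sandwich[OF _ _ tendsto_const le])
      (use M(2) ge in \<open>auto intro!: always_eventually less_imp_le\<close>)
  obtain s :: "nat \<Rightarrow> nat" and c :: "nat \<Rightarrow> real" and r where s: "strict_mono s" and r: "r \<noteq> 0" "degree r \<le> n"
    and lim: "\<And>x l. x \<longlonglongrightarrow> l \<Longrightarrow> (\<lambda>k. complex_of_real (c k) * twist \<omega> (q (s k)) (x k)) \<longlonglongrightarrow> twist \<omega> r l"
    using twist_sequence_compact[of q n, OF q(2,1) tendsto_const[of \<omega>]] by blast
  have "tan_bounded \<omega> (best_tan n \<omega>) r"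
  proof (rule tan_bounded_limit[where \<Omega> = "\<lambda>_. \<omega>" and p = "\<lambda>k. q (s k)" and c = c])
    show "(\<lambda>k. M (s k)) \<longlonglongrightarrow> best_tan n \<omega>"
      using LIMSEQ_subseq_LIMSEQ[OF \<open>M \<longlonglongrightarrow> best_tan n \<omega>\<close> s] by (simp add: o_def)
  qed (fact lim q(3))+
  moreover obtain p0 d where d: "r = p0 * d" "d \<noteq> 0" "pdagger d = d" "coprime p0 (pdagger p0)"
    using pdagger_reduce[OF r(1)] .
  ultimately have "tan_bounded \<omega> (best_tan n \<omega>) p0" using tan_bounded_reduce by blast
  moreover have "degree p0 \<le> n" using r d by (auto simp: degree_mult_eq)
  ultimately show "\<exists>p. degree p \<le> n \<and> coprime p (pdagger p) \<and> tan_bounded \<omega> (best_tan n \<omega>) p"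
    using d(4) by blast
qed

text \<open>A minimiser, normalised so that the twist stays in the right half plane.\<close>

definition best_poly :: "nat \<Rightarrow> real \<Rightarrow> complex poly \<Rightarrow> bool" where
  "best_poly n \<omega> p \<longleftrightarrow> degree p \<le> n \<and> coprime p (pdagger p) \<and>
     (\<forall>x\<in>{-1..1}. Re (twist \<omega> p x) > 0) \<and> tan_bounded \<omega> (best_tan n \<omega>) p"

lemma best_polyD:
  assumes "best_poly n \<omega> p"
  shows "degree p \<le> n" "coprime p (pdagger p)" "p \<noteq> 0" "tan_bounded \<omega> (best_tan n \<omega>) p"
    "\<And>x. x \<in> {-1..1} \<Longrightarrow> Re (twist \<omega> p x) > 0"
    "\<And>x. x \<in> {-1..1} \<Longrightarrow> \<bar>slope \<omega> p x\<bar> \<le> best_tan n \<omega>"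
proof -
  show pos: "\<And>x. x \<in> {-1..1} \<Longrightarrow> Re (twist \<omega> p x) > 0" 
    and "degree p \<le> n" "coprime p (pdagger p)" "tan_bounded \<omega> (best_tan n \<omega>) p"
    using assms by (auto simp: best_poly_def)
  then show "p \<noteq> 0" by auto
  fix x :: real assume x: "x \<in> {-1..1}"
  then have "\<bar>Im (twist \<omega> p x)\<bar> \<le> best_tan n \<omega> * \<bar>Re (twist \<omega> p x)\<bar>"
    using assms by (auto simp: best_poly_def tan_bounded_def)
  then show "\<bar>slope \<omega> p x\<bar> \<le> best_tan n \<omega>"
    using pos[OF x] by (simp add: slope_def abs_divide divide_le_eq)
qed

text \<open>A zero of the real part would force a zero of the imaginary part as well, hence a root of \<open>p\<close>
on the imaginary axis.\<close>

lemma tan_bounded_sign: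
  assumes "coprime p (pdagger p)" "tan_bounded \<omega> M p"
  shows "(\<forall>x\<in>{-1..1}. Re (twist \<omega> p x) > 0) \<or> (\<forall>x\<in>{-1..1}. Re (twist \<omega> p x) < 0)"
proof -
  have nz: "Re (twist \<omega> p x) \<noteq> 0" if "x \<in> {-1..1}" for x
  proof
    assume "Re (twist \<omega> p x) = 0"
    then have "twist \<omega> p x = 0"
      using assms(2) that by (force simp: tan_bounded_def complex_eq_iff)
    then show False
      using coprime_pdagger_no_imaginary_root[OF assms(1)] by (simp add: twist_eq_0_iff)
  qed
  have "connected ((\<lambda>x. Re (twist \<omega> p x)) ` {-1..1})"
    by (intro connected_continuous_image continuous_intros) auto
  then have "\<not> (a < 0 \<and> 0 < b)" if "a \<in> (\<lambda>x. Re (twist \<omega> p x)) ` {-1..1}" "b \<in> (\<lambda>x. Re (twist \<omega> p x)) ` {-1..1}" for a b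
    using that nz connectedD_interval[of "(\<lambda>x. Re (twist \<omega> p x)) ` {-1..1}" a b 0] by fastforce
  then show ?thesis using nz by (metis image_eqI linorder_neqE_linordered_idom)
qed

lemma tan_bounded_smult:
  "c \<noteq> 0 \<Longrightarrow> tan_bounded \<omega> M (smult (complex_of_real c) p) \<longleftrightarrow> tan_bounded \<omega> M p"
  by (simp add: tan_bounded_def twist_smult abs_mult mult.left_commute)

lemma best_poly_of_tan_bounded:
  assumes "degree p \<le> n" "coprime p (pdagger p)" "tan_bounded \<omega> (best_tan n \<omega>) p"
  shows "best_poly n \<omega> p \<or> best_poly n \<omega> (- p)"
proof -
  have "pdagger (- p) = - pdagger p" using pdagger_smult[of "-1" p] by simp
  moreover have "tan_bounded \<omega> (best_tan n \<omega>) (- p)" using assms(3) tan_bounded_smult[of "-1"] by simp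
  moreover have "twist \<omega> (- p) x = - twist \<omega> p x" for x using twist_smult[of \<omega> "-1" p] by simp
  ultimately show ?thesis
    using tan_bounded_sign[OF assms(2,3)] assms by (auto simp: best_poly_def)
qed

lemma best_poly_exists:
  assumes "0 < \<omega>" "\<omega> < (real n + 1) * pi"
  shows "\<exists>p. best_poly n \<omega> p"
  using best_tan_attained(2)[OF assms] best_poly_of_tan_bounded by blast

section \<open>Interpolation and Bezout identities\<close>

lemma interpolation_exists:
  fixes v :: "'a::field \<Rightarrow> 'a"
  assumes "finite A"
  shows "\<exists>P. degree P \<le> card A - 1 \<and> (\<forall>a\<in>A. poly P a = v a)"
  using assms
proof induction
  case empty
  then show ?case by (auto intro: exI[of _ 0])
next
  case (insert b A)
  then obtain P where P: "degree P \<le> card A - 1" "\<forall>a\<in>A. poly P a = v a" by blast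
  define R where "R = (\<Prod>a\<in>A. [:- a, 1:])"
  have R0: "poly R b \<noteq> 0" "\<forall>a\<in>A. poly R a = 0"
    using insert.hyps by (auto simp: R_def poly_prod prod_zero_iff)
  have "degree R \<le> card A"
    unfolding R_def using degree_prod_sum_le[OF insert.hyps(1), of "\<lambda>a. [:- a, 1:]"] by simp
  then have "degree (P + smult ((v b - poly P b) / poly R b) R) \<le> card (insert b A) - 1"
    using P(1) insert.hyps by (intro degree_add_le order_trans[OF degree_smult_le]) auto
  moreover have "\<forall>a\<in>insert b A. poly (P + smult ((v b - poly P b) / poly R b) R) a = v a"
    using P(2) R0 by simp
  ultimately show ?case by blast
qed

text \<open>The left-hand side is the leading coefficient of the Lagrange interpolant of \<open>P\<close> on \<open>A\<close>, which
coincides with \<open>P\<close> and therefore has too small a degree.\<close>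

lemma lagrange_leading_coeff:
  fixes P :: "'a::field poly"
  assumes "finite A" "degree P + 1 < card A"
  shows "(\<Sum>a\<in>A. poly P a / (\<Prod>b\<in>A - {a}. a - b)) = 0"
proof -
  define R where "R a = (\<Prod>b\<in>A - {a}. [:- b, 1:])" for a
  define W where "W a = (\<Prod>b\<in>A - {a}. a - b)" for a
  define L where "L = (\<Sum>a\<in>A. smult (poly P a / W a) (R a))"
  have W0: "W a \<noteq> 0" for a using assms(1) by (auto simp: W_def prod_zero_iff)
  have RW: "poly (R a) a = W a" for a by (simp add: R_def W_def poly_prod)
  have R0: "poly (R a) c = 0" if "c \<in> A" "c \<noteq> a" for a c
    using that assms(1) by (auto simp: R_def poly_prod prod_zero_iff)
  have dR: "degree (R a) = card A - 1" if "a \<in> A" for a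
    unfolding R_def using that assms(1) by (subst degree_prod_eq_sum_degree) auto
  have lR: "coeff (R a) (card A - 1) = 1" if "a \<in> A" for a
    using dR[OF that] lead_coeff_prod[of "\<lambda>b. [:- b, 1:]" "A - {a}"] by (simp add: R_def)
  have "L = P"
  proof (rule poly_eqI_degree[of A])
    fix c assume c: "c \<in> A"
    have "poly L c = (\<Sum>a\<in>A. if a = c then poly P c else 0)"
      unfolding L_def poly_sum using R0[OF c] RW W0 by (intro sum.cong) auto
    then show "poly L c = poly P c" using c assms(1) by simp
  next
    have "degree L \<le> card A - 1" unfolding L_def
      by (intro degree_sum_le order_trans[OF degree_smult_le]) (use assms(1) dR in auto)
    then show "degree L < card A" using assms(2) by simp
  qed (use assms in auto)
  then have "coeff L (card A - 1) = 0" using assms(2) by (simp add: coeff_eq_0)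
  moreover have "coeff L (card A - 1) = (\<Sum>a\<in>A. poly P a / W a)"
    by (simp add: L_def coeff_sum lR[unfolded One_nat_def])
  ultimately show ?thesis by (simp add: W_def)
qed

text \<open>Every prescribed \<open>T\<close> of degree at most \<open>n + degree p\<close> is the first-order change of the argument
for some admissible perturbation \<open>d\<close>. Write \<open>T = p A + p\<^sup>\<dagger> B\<close> with \<open>A\<close> reduced modulo \<open>p\<^sup>\<dagger>\<close>, which
keeps the degree of \<open>B\<close> at most \<open>n\<close>; on the imaginary axis \<open>Im (p\<^sup>\<dagger> B) = - Im (p B\<^sup>\<dagger>)\<close>, so
\<open>d = A\<^sup>\<dagger> - B\<close> does it.\<close>

lemma pdagger_bezout:
  assumes "coprime p (pdagger p)" "degree p \<le> n" "degree T \<le> n + degree p"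
  obtains d where "degree d \<le> n"
    "\<And>x. Im (poly (p * pdagger d) (\<i> * complex_of_real x)) = Im (poly T (\<i> * complex_of_real x))"
proof -
  have p0: "p \<noteq> 0" using assms by auto
  obtain a b where ab: "a * p + b * pdagger p = 1"
    using bezout_coefficients_fst_snd[of p "pdagger p"] assms(1) by (metis coprime_iff_gcd_eq_1)
  define X where "X = (a * T) div pdagger p"
  define A where "A = (a * T) mod pdagger p"
  define B where "B = b * T + X * p"
  have aT: "a * T = X * pdagger p + A" by (simp add: X_def A_def)
  have "p * A + pdagger p * B = p * (X * pdagger p + A) + pdagger p * (b * T)"
    by (simp add: B_def algebra_simps)
  also have "\<dots> = (a * p + b * pdagger p) * T"
    unfolding aT [symmetric] by (simp add: algebra_simps)
  finally have AB: "p * A + pdagger p * B = T" by (simp add: ab)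
  have dA: "degree A \<le> degree p"
    using degree_mod_less[of "pdagger p" "a * T"] p0 by (auto simp: A_def)
  have dB: "degree B \<le> n"
  proof (cases "B = 0")
    case False
    have "degree p + degree B = degree (pdagger p * B)" using p0 False by (simp add: degree_mult_eq)
    also have "pdagger p * B = T - p * A" using AB by (simp add: algebra_simps)
    also have "degree (T - p * A) \<le> n + degree p"
      by (intro degree_diff_le assms order_trans[OF degree_mult_le]) (use dA assms(2) in auto)
    finally show ?thesis by simp
  qed simp
  show ?thesis
  proof (rule that[of "pdagger A - B"])
    show "degree (pdagger A - B) \<le> n"
      using dA dB assms(2) by (intro degree_diff_le) auto
    fix x
    show "Im (poly (p * pdagger (pdagger A - B)) (\<i> * complex_of_real x))
        = Im (poly T (\<i> * complex_of_real x))"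
      unfolding AB [symmetric] by (simp add: pdagger_diff algebra_simps)
  qed
qed

section \<open>Critical points of the tangent\<close>

text \<open>On the imaginary axis this is \<open>2 \<i> Im (w' * cnj w)\<close> for the twist \<open>w\<close>, the numerator of the
derivative of \<open>Im w / Re w\<close>.\<close>

definition critical_poly :: "real \<Rightarrow> complex poly \<Rightarrow> complex poly" where
  "critical_poly \<omega> p = smult \<i> (pderiv p * pdagger p + pdagger (pderiv p) * p)
     + smult (\<i> * \<omega>) (p * pdagger p)"

lemma twist_has_vector_derivative:
  "(twist \<omega> p has_vector_derivative
     (\<i> * poly (pderiv p) (\<i> * x) + \<i> * \<omega> / 2 * poly p (\<i> * x)) * cis (\<omega> * x / 2)) (at x within S)"
proof -
  have "((\<lambda>z. poly p (\<i> * z) * exp (\<i> * \<omega> / 2 * z)) has_field_derivative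
     (\<i> * poly (pderiv p) (\<i> * z) + \<i> * \<omega> / 2 * poly p (\<i> * z)) * exp (\<i> * \<omega> / 2 * z)) (at z)" for z
    by (rule derivative_eq_intros poly_DERIV[THEN DERIV_chain2] refl | simp add: algebra_simps)+
  from has_vector_derivative_real_field[OF this[of "complex_of_real x"]]
  show ?thesis by (simp add: twist_def [abs_def] cis_conv_exp mult_ac)
qed

lemma slope_has_derivative:
  assumes "Re (twist \<omega> p x) \<noteq> 0"
  shows "(slope \<omega> p has_real_derivative
     Im (poly (critical_poly \<omega> p) (\<i> * x)) / (2 * (Re (twist \<omega> p x))\<^sup>2)) (at x)"
proof -
  define w' where "w' = (\<i> * poly (pderiv p) (\<i> * x) + \<i> * \<omega> / 2 * poly p (\<i> * x)) * cis (\<omega> * x / 2)"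
  define w where "w = twist \<omega> p x"
  have d: "(twist \<omega> p has_vector_derivative w') (at x)"
    unfolding w'_def by (rule twist_has_vector_derivative)
  have "(slope \<omega> p has_real_derivative (Im w' * Re w - Im w * Re w') / (Re w * Re w)) (at x)"
    unfolding slope_def [abs_def] w_def
    by (intro DERIV_divide has_field_derivative_Re has_field_derivative_Im d assms)
  also have "Im w' * Re w - Im w * Re w' = Im (w' * cnj w)" by simp
  also have "w' * cnj w = (\<i> * poly (pderiv p) (\<i> * x) + \<i> * \<omega> / 2 * poly p (\<i> * x)) * cnj (poly p (\<i> * x))
      * (cis (\<omega> * x / 2) * cnj (cis (\<omega> * x / 2)))"
    by (simp add: w'_def w_def twist_def)
  also have "cis (\<omega> * x / 2) * cnj (cis (\<omega> * x / 2)) = 1" by (simp add: cis_cnj cis_mult)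
  also have "Im ((\<i> * poly (pderiv p) (\<i> * x) + \<i> * \<omega> / 2 * poly p (\<i> * x)) * cnj (poly p (\<i> * x)) * 1)
      = Im (poly (critical_poly \<omega> p) (\<i> * x)) / 2"
    by (simp add: critical_poly_def algebra_simps add_divide_distrib)
  finally show ?thesis by (simp add: w_def power2_eq_square)
qed

text \<open>The summand \<open>\<i> \<omega> p p\<^sup>\<dagger>\<close> has exact degree \<open>2 * degree p\<close> and dominates the derivative terms; this
is where \<open>\<omega> \<noteq> 0\<close> enters.\<close>

lemma critical_poly_roots:
  assumes "p \<noteq> 0" "\<omega> \<noteq> 0"
  shows "finite {x::real. Im (poly (critical_poly \<omega> p) (\<i> * x)) = 0}"
    "card {x::real. Im (poly (critical_poly \<omega> p) (\<i> * x)) = 0} \<le> 2 * degree p"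
proof -
  define Q where "Q = pderiv p * pdagger p + pdagger (pderiv p) * p"
  have Re0: "Re (poly (critical_poly \<omega> p) (\<i> * complex_of_real x)) = 0" for x
    by (simp add: critical_poly_def)
  have deg2: "degree (p * pdagger p) = 2 * degree p" using assms by (simp add: degree_mult_eq)
  have Q: "Q = 0 \<or> degree Q < 2 * degree p"
  proof (cases "degree p = 0")
    case True
    then have "pderiv p = 0" by (simp add: pderiv_eq_0_iff)
    then show ?thesis by (simp add: Q_def)
  next
    case False
    have "degree Q \<le> (degree p - 1) + degree p" unfolding Q_def
      by (intro degree_add_le order_trans[OF degree_mult_le]) (simp_all add: degree_pderiv)
    with False show ?thesis by linarith
  qed
  have "critical_poly \<omega> p \<noteq> 0"
  proof
    assume "critical_poly \<omega> p = 0"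
    then have "smult (\<i> * \<omega>) (p * pdagger p) = smult (- \<i>) Q"
      by (simp add: critical_poly_def Q_def [symmetric] add_eq_0_iff)
    then have "degree (p * pdagger p) = degree Q" "Q \<noteq> 0"
      using assms by (metis degree_smult_eq complex_i_not_zero mult_eq_0_iff neg_equal_0_iff_equal of_real_eq_0_iff, force)
    with Q deg2 show False by simp
  qed
  moreover have "degree (critical_poly \<omega> p) \<le> 2 * degree p"
    unfolding critical_poly_def Q_def [symmetric]
    using Q deg2 by (intro degree_add_le order_trans[OF degree_smult_le]) auto
  ultimately have fin: "finite {z. poly (critical_poly \<omega> p) z = 0}"
    and card: "card {z. poly (critical_poly \<omega> p) z = 0} \<le> 2 * degree p"
    using poly_roots_finite card_poly_roots_bound[of "critical_poly \<omega> p"] by (auto intro: order_trans)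
  have sub: "(\<lambda>x. \<i> * complex_of_real x) ` {x. Im (poly (critical_poly \<omega> p) (\<i> * x)) = 0}
      \<subseteq> {z. poly (critical_poly \<omega> p) z = 0}"
    using Re0 by (auto simp: complex_eq_iff)
  have inj: "inj_on (\<lambda>x. \<i> * complex_of_real x) S" for S by (auto simp: inj_on_def)
  show "finite {x::real. Im (poly (critical_poly \<omega> p) (\<i> * x)) = 0}"
    using inj_on_finite[OF inj sub fin] .
  show "card {x::real. Im (poly (critical_poly \<omega> p) (\<i> * x)) = 0} \<le> 2 * degree p"
    using card_inj_on_le[OF inj sub fin] card by simp
qed


text \<open>On fewer points, interpolation and \<open>pdagger_bezout\<close> give a perturbation \<open>d\<close> for which
\<open>Im (w * cnj (twist \<omega> d))\<close> equals the slope at every extremal point. Moving along \<open>d\<close> decreases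
\<open>(Im w)\<^sup>2 - M\<^sup>2 (Re w)\<^sup>2\<close> to first order where it vanishes, and \<open>first_order_decrease\<close> turns this
into a uniform improvement of the minimal \<open>M\<close>.\<close>

lemma extremal_card_ge:
  assumes best: "best_poly n \<omega> p" and M: "best_tan n \<omega> > 0"
  defines "A \<equiv> {x \<in> {-1..1}. \<bar>slope \<omega> p x\<bar> = best_tan n \<omega>}"
  assumes fin: "finite A"
  shows "n + degree p + 2 \<le> card A"
proof (rule ccontr)
  note p = best_polyD[OF best]
  define M where "M = best_tan n \<omega>"
  assume "\<not> n + degree p + 2 \<le> card A"
  then have small: "card A - 1 \<le> n + degree p" by simp
  have cardi: "card ((\<lambda>x. \<i> * complex_of_real x) ` A) = card A"
    by (intro card_image) (auto simp: inj_on_def)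
  obtain T where T: "degree T \<le> card A - 1"
      "\<forall>a\<in>(\<lambda>x. \<i> * complex_of_real x) ` A. poly T a = \<i> * complex_of_real (slope \<omega> p (Im a))"
    using interpolation_exists[of "(\<lambda>x. \<i> * complex_of_real x) ` A" "\<lambda>a. \<i> * complex_of_real (slope \<omega> p (Im a))"]
      fin cardi by auto
  then obtain d where d: "degree d \<le> n"
      "\<And>x. Im (poly (p * pdagger d) (\<i> * complex_of_real x)) = Im (poly T (\<i> * complex_of_real x))"
    using pdagger_bezout[OF p(2,1), of T] small by auto
  define w e where "w = twist \<omega> p" and "e = twist \<omega> d"
  have we: "Im (w x) * Re (e x) - Re (w x) * Im (e x) = slope \<omega> p x" if "x \<in> A" for x
    using Im_twist_mult_cnj[of \<omega> p x d] d(2)[of x] T(2) that by (simp add: w_def e_def)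
  have cont: "continuous_on S w" "continuous_on S e" for S
    unfolding w_def e_def by (intro continuous_intros)+
  have "\<exists>t>0. \<forall>x\<in>{-1..1}. ((Im (w x))\<^sup>2 - M\<^sup>2 * (Re (w x))\<^sup>2)
      + t * (2 * Im (w x) * Im (e x) - 2 * M\<^sup>2 * Re (w x) * Re (e x))
      + t\<^sup>2 * ((Im (e x))\<^sup>2 - M\<^sup>2 * (Re (e x))\<^sup>2) < 0"
  proof (rule first_order_decrease)
    fix x :: real assume x: "x \<in> {-1..1}"
    have r: "Re (w x) > 0" using p(5)[OF x] by (simp add: w_def)
    have "(Im (w x))\<^sup>2 - M\<^sup>2 * (Re (w x))\<^sup>2 = ((slope \<omega> p x)\<^sup>2 - M\<^sup>2) * (Re (w x))\<^sup>2"
      using r by (simp add: slope_def w_def [symmetric] field_simps)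
    moreover have "(slope \<omega> p x)\<^sup>2 \<le> M\<^sup>2"
      using p(6)[OF x] by (intro abs_le_square_iff[THEN iffD1]) (simp add: M_def)
    ultimately show "(Im (w x))\<^sup>2 - M\<^sup>2 * (Re (w x))\<^sup>2 \<le> 0"
      by (simp add: mult_le_0_iff)
    assume z: "(Im (w x))\<^sup>2 - M\<^sup>2 * (Re (w x))\<^sup>2 = 0"
    then have "(slope \<omega> p x)\<^sup>2 = M\<^sup>2"
      using r by (simp add: slope_def w_def [symmetric] field_simps)
    then have "\<bar>slope \<omega> p x\<bar> = M" using M by (simp add: M_def power2_eq_iff abs_if split: if_splits) auto
    then have xA: "x \<in> A" using x by (simp add: A_def M_def)
    have "Re (w x) * (2 * Im (w x) * Im (e x) - 2 * M\<^sup>2 * Re (w x) * Re (e x))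
       = 2 * Im (w x) * (Im (e x) * Re (w x)) - 2 * (M\<^sup>2 * (Re (w x))\<^sup>2) * Re (e x)"
      by (simp add: power2_eq_square algebra_simps)
    also have "M\<^sup>2 * (Re (w x))\<^sup>2 = (Im (w x))\<^sup>2" using z by simp
    also have "2 * Im (w x) * (Im (e x) * Re (w x)) - 2 * (Im (w x))\<^sup>2 * Re (e x)
       = - 2 * Im (w x) * (Im (w x) * Re (e x) - Re (w x) * Im (e x))"
      by (simp add: power2_eq_square algebra_simps)
    also have "\<dots> = Re (w x) * (- 2 * (slope \<omega> p x)\<^sup>2)"
      unfolding we[OF xA] using r by (simp add: slope_def w_def [symmetric] power2_eq_square)
    finally have "2 * Im (w x) * Im (e x) - 2 * M\<^sup>2 * Re (w x) * Re (e x) = - 2 * (slope \<omega> p x)\<^sup>2"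
      using r by (simp only: mult_cancel_left) auto
    then have "2 * Im (w x) * Im (e x) - 2 * M\<^sup>2 * Re (w x) * Re (e x) = - 2 * M\<^sup>2"
      by (simp only: \<open>(slope \<omega> p x)\<^sup>2 = M\<^sup>2\<close>)
    then show "2 * Im (w x) * Im (e x) - 2 * M\<^sup>2 * Re (w x) * Re (e x) < 0"
      using M by (simp add: M_def)
  qed (auto intro!: continuous_intros cont)
  then obtain t where t: "\<And>x. x \<in> {-1..1} \<Longrightarrow> ((Im (w x))\<^sup>2 - M\<^sup>2 * (Re (w x))\<^sup>2)
      + t * (2 * Im (w x) * Im (e x) - 2 * M\<^sup>2 * Re (w x) * Re (e x))
      + t\<^sup>2 * ((Im (e x))\<^sup>2 - M\<^sup>2 * (Re (e x))\<^sup>2) < 0" by blast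
  define q where "q = p + smult (complex_of_real t) d"
  have less: "(Im (twist \<omega> q x))\<^sup>2 < (M * Re (twist \<omega> q x))\<^sup>2" if "x \<in> {-1..1}" for x
    using t[OF that] by (simp add: q_def twist_add twist_smult w_def e_def power2_eq_square algebra_simps)
  then have nz: "Re (twist \<omega> q x) \<noteq> 0" if "x \<in> {-1..1}" for x
    using that by (metis mult_zero_right not_less zero_le_power2 power_zero_numeral)
  have S: "\<bar>slope \<omega> q x\<bar> < M" if x: "x \<in> {-1..1}" for x
  proof -
    have "\<bar>Im (twist \<omega> q x)\<bar> < \<bar>M * Re (twist \<omega> q x)\<bar>"
      by (rule power2_less_imp_less) (simp_all only: power2_abs less[OF x] abs_ge_zero)
    then show ?thesis using nz[OF x] M by (simp add: slope_def abs_divide divide_less_eq abs_mult M_def)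
  qed
  obtain x where x: "x \<in> {-1..1}" "norm (slope \<omega> q x) = max_norm (slope \<omega> q)"
    by (rule max_norm_attained[OF continuous_on_slope[OF nz]])
  have "max_norm (slope \<omega> q) < M" "max_norm (slope \<omega> q) \<ge> 0"
    using S[OF x(1)] by (simp_all flip: x(2))
  moreover have "best_tan n \<omega> \<le> max_norm (slope \<omega> q)"
  proof (rule best_tan_le)
    show "q \<noteq> 0" using nz[of 0] by (auto simp: twist_def)
    show "degree q \<le> n" unfolding q_def
      by (intro degree_add_le order_trans[OF degree_smult_le] p d)
    show "tan_bounded \<omega> (max_norm (slope \<omega> q)) q" by (rule tan_bounded_max_slope[OF nz])
  qed fact
  ultimately show False by (simp add: M_def)
qed

section \<open>Equioscillation\<close>

definition extremals :: "(real \<Rightarrow> real) \<Rightarrow> real set" where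
  "extremals f = {x \<in> {-1..1}. \<bar>f x\<bar> = max_norm f}"

text \<open>The structure of the phase error that determines the extremal points and the nodes. Consecutive
extremal points are described by an empty gap, which avoids any enumeration.\<close>

definition equioscillating :: "nat \<Rightarrow> (real \<Rightarrow> real) \<Rightarrow> bool" where
  "equioscillating n f \<longleftrightarrow> 0 < max_norm f \<and> continuous_on {-1..1} f \<and>
     card (extremals f) = 2 * n + 2 \<and> -1 \<in> extremals f \<and> 1 \<in> extremals f \<and>
     (\<forall>a\<in>extremals f. \<forall>b\<in>extremals f. a < b \<and> extremals f \<inter> {a<..<b} = {} \<longrightarrow>
        f b = - f a \<and> (\<exists>!x. x \<in> {a<..<b} \<and> f x = 0))"

text \<open>Interior extremal points are critical points. The count \<open>n + m + 2 \<le> card E \<le> 2 + 2 m\<close> with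
\<open>m \<le> n\<close> is tight, so \<open>m = n\<close>, both endpoints are extremal, and every critical point is an
extremal point. The mean value theorem then excludes equal values at neighbouring extremal points
and a second zero between them.\<close>

lemma best_poly_equioscillating:
  assumes "0 < \<omega>" "\<omega> < (real n + 1) * pi" and best: "best_poly n \<omega> p"
  shows "equioscillating n (slope \<omega> p)" "degree p = n" "max_norm (slope \<omega> p) = best_tan n \<omega>"
proof -
  note p = best_polyD[OF best]
  define M where "M = best_tan n \<omega>"
  define f where "f = slope \<omega> p"
  define F where "F x = Im (poly (critical_poly \<omega> p) (\<i> * x)) / (2 * (Re (twist \<omega> p x))\<^sup>2)" for x
  define Z where "Z = {x::real. Im (poly (critical_poly \<omega> p) (\<i> * x)) = 0}"
  define E where "E = {x \<in> {-1..1}. \<bar>f x\<bar> = M}"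
  have Re0: "Re (twist \<omega> p x) \<noteq> 0" if "x \<in> {-1..1}" for x using p(5)[OF that] by simp
  have cont: "continuous_on {-1..1} f" unfolding f_def by (rule continuous_on_slope[OF Re0])
  have der: "DERIV f x :> F x" if "x \<in> {-1..1}" for x
    unfolding f_def F_def by (rule slope_has_derivative[OF Re0[OF that]])
  have FZ: "F x = 0 \<longleftrightarrow> x \<in> Z" if "x \<in> {-1..1}" for x
    using Re0[OF that] by (simp add: F_def Z_def)
  have Z: "finite Z" "card Z \<le> 2 * degree p"
    using critical_poly_roots[of p \<omega>] p(3) assms(1) by (auto simp: Z_def)
  have bound: "\<bar>f x\<bar> \<le> M" if "x \<in> {-1..1}" for x using p(6)[OF that] by (simp add: f_def M_def)
  have crit: "x \<in> Z" if x: "x \<in> E" "-1 < x" "x < 1" for x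
  proof -
    define d where "d = min (x + 1) (1 - x)"
    have d: "d > 0" using x by (simp add: d_def)
    have near: "y \<in> {-1..1}" if "\<bar>x - y\<bar> < d" for y using that by (auto simp: d_def)
    have "F x = 0"
    proof (cases "f x \<ge> 0")
      case True
      then have "f x = M" using x by (simp add: E_def)
      then have "\<forall>y. \<bar>x - y\<bar> < d \<longrightarrow> f y \<le> f x" using bound near by (auto simp: abs_le_iff)
      then show ?thesis using DERIV_local_max[OF der d] x by auto
    next
      case False
      then have "f x = - M" using x by (simp add: E_def)
      then have "\<forall>y. \<bar>x - y\<bar> < d \<longrightarrow> f x \<le> f y" using bound near by (auto simp: abs_le_iff) (metis minus_le_iff)
      then show ?thesis using DERIV_local_min[OF der d] x by auto
    qed
    then show ?thesis using FZ x by simp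
  qed
  have "M \<ge> 0" using bound[of 0] by simp
  have M: "M > 0"
  proof (rule ccontr)
    assume "\<not> M > 0"
    with \<open>M \<ge> 0\<close> have "M = 0" by simp
    then have "{-1<..<1} \<subseteq> Z" using crit bound by (auto simp: E_def)
    then have "finite {-1<..<1::real}" using Z(1) finite_subset by blast
    then show False by (simp add: infinite_Ioo)
  qed
  define I where "I = E \<inter> {-1<..<1}"
  have IZ: "I \<subseteq> Z" using crit by (auto simp: I_def)
  then have fI: "finite I" using Z(1) finite_subset by blast
  have E_sub: "E \<subseteq> insert (-1) (insert 1 I)" by (auto simp: I_def E_def)
  then have finE: "finite E" using fI by (meson finite_insert finite_subset)
  have lower: "n + degree p + 2 \<le> card E"
    using extremal_card_ge[OF best] M finE by (simp add: E_def M_def f_def)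
  have cI: "card I \<le> 2 * degree p" using card_mono[OF Z(1) IZ] Z(2) by linarith
  have "card E \<le> card (insert (-1) (insert 1 I))" using E_sub fI by (intro card_mono) auto
  then have upper: "card E \<le> 2 + card I" using card_insert_le_m1 fI
    by (simp add: card_insert_if split: if_splits)
  show deg: "degree p = n" using lower upper cI p(1) by linarith
  have cE: "card E = 2 * n + 2" and cI': "card I = 2 * n"
    using lower upper cI deg by linarith+
  have m1: "-1 \<in> E"
  proof (rule ccontr)
    assume "-1 \<notin> E"
    then have "card E \<le> card (insert 1 I)" using E_sub fI by (intro card_mono) auto
    also have "\<dots> \<le> 1 + card I" using fI by (simp add: card_insert_if)
    finally show False using cE cI' by simp
  qed
  have p1: "1 \<in> E"
  proof (rule ccontr)
    assume "1 \<notin> E"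
    then have "card E \<le> card (insert (-1) I)" using E_sub fI by (intro card_mono) auto
    also have "\<dots> \<le> 1 + card I" using fI by (simp add: card_insert_if)
    finally show False using cE cI' by simp
  qed
  \<comment> \<open>All bounds of the count are sharp: the interior extremal points exhaust the critical points.\<close>
  have "I = Z" using Z IZ cI' deg by (intro card_seteq) auto
  then have ZE: "Z \<subseteq> E" by (auto simp: I_def)
  show mx: "max_norm (slope \<omega> p) = best_tan n \<omega>"
  proof (rule antisym)
    show "max_norm (slope \<omega> p) \<le> best_tan n \<omega>"
      using bound max_norm_le_iff[OF cont] by (simp add: f_def M_def)
    have "norm (f 1) \<le> max_norm f" using max_norm_le_iff[OF cont, of "max_norm f"] by simp
    then show "best_tan n \<omega> \<le> max_norm (slope \<omega> p)" using p1 by (simp add: E_def f_def M_def)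
  qed
  have ext: "extremals f = E" by (simp add: extremals_def E_def f_def mx M_def)
  have mv: "f b \<noteq> f a" if ab: "a \<in> {-1..1}" "b \<in> {-1..1}" "a < b" "E \<inter> {a<..<b} = {}" for a b
  proof -
    have "\<exists>z>a. z < b \<and> f b - f a = (b - a) * F z"
      using ab by (intro MVT2 der) auto
    then obtain z where z: "a < z" "z < b" "f b - f a = (b - a) * F z" by auto
    then have "z \<notin> Z" using ab(4) ZE by auto
    then have "F z \<noteq> 0" using FZ[of z] z ab by auto
    then show ?thesis using z by auto
  qed
  have consec: "f b = - f a \<and> (\<exists>!x. x \<in> {a<..<b} \<and> f x = 0)"
    if ab: "a \<in> E" "b \<in> E" "a < b" "E \<inter> {a<..<b} = {}" for a b
  proof
    have ab1: "a \<in> {-1..1}" "b \<in> {-1..1}" and fab: "\<bar>f a\<bar> = M" "\<bar>f b\<bar> = M" using ab by (auto simp: E_def)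
    show op: "f b = - f a" using mv[OF ab1 ab(3,4)] fab by (auto simp: abs_if split: if_splits)
    have cab: "continuous_on {a..b} f" using ab1 by (intro continuous_on_subset[OF cont]) auto
    have "\<exists>x. a \<le> x \<and> x \<le> b \<and> f x = 0"
    proof (cases "f a \<le> 0")
      case True
      then show ?thesis using IVT'[of f a 0 b] op ab(3) cab by auto
    next
      case False
      then show ?thesis using IVT2'[of f b 0 a] op ab(3) cab by auto
    qed
    then obtain x where x: "a \<le> x" "x \<le> b" "f x = 0" by blast
    moreover have "x \<noteq> a" "x \<noteq> b" using x(3) fab M by auto
    ultimately have "x \<in> {a<..<b} \<and> f x = 0" by auto
    moreover have "y = x'" if "y \<in> {a<..<b} \<and> f y = 0" "x' \<in> {a<..<b} \<and> f x' = 0" for y x'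
    proof (rule ccontr)
      assume "y \<noteq> x'"
      then consider "y < x'" | "x' < y" by linarith
      then show False
      proof cases
        case 1
        then show False using mv[of y x'] that ab1 ab(4) by fastforce
      next
        case 2
        then show False using mv[of x' y] that ab1 ab(4) by fastforce
      qed
    qed
    ultimately show "\<exists>!x. x \<in> {a<..<b} \<and> f x = 0" by blast
  qed
  have "equioscillating n f"
    unfolding equioscillating_def ext using cont M mx cE m1 p1 consec by (simp add: f_def M_def)
  then show "equioscillating n (slope \<omega> p)" by (simp add: f_def)
qed

text \<open>An odd function whose modulus increases with that of its argument moves neither extremal points nor zeros;
applied to \<open>- 2 arctan\<close> this passes from the tangent to the phase error.\<close>

lemma equioscillating_compose:
  fixes h :: "real \<Rightarrow> real"
  assumes f: "equioscillating n f" and g: "\<And>x. x \<in> {-1..1} \<Longrightarrow> g x = h (f x)"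
    and mono: "\<And>s t. \<bar>s\<bar> < \<bar>t\<bar> \<Longrightarrow> \<bar>h s\<bar> < \<bar>h t\<bar>" and odd: "\<And>t. h (- t) = - h t"
    and cont: "continuous_on UNIV h"
  shows "equioscillating n g" "extremals g = extremals f"
proof -
  have cf: "continuous_on {-1..1} f" using f by (simp add: equioscillating_def)
  have h0: "h 0 = 0" using odd[of 0] by simp
  have eq: "\<bar>h s\<bar> = \<bar>h t\<bar> \<longleftrightarrow> \<bar>s\<bar> = \<bar>t\<bar>" for s t
    using mono[of s t] mono[of t s] odd[of s] odd[of t] by (metis abs_eq_iff abs_minus_cancel less_irrefl linorder_neqE_linordered_idom)
  have le: "\<bar>h s\<bar> \<le> \<bar>h t\<bar>" if "\<bar>s\<bar> \<le> \<bar>t\<bar>" for s t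
    using that mono[of s t] eq[of s t] by linarith
  have z: "h s = 0 \<longleftrightarrow> s = 0" for s using eq[of s 0] h0 by auto
  have cg: "continuous_on {-1..1} g"
    using continuous_on_compose2[OF cont cf] g by (auto cong: continuous_on_cong_simp)
  obtain x0 where x0: "x0 \<in> {-1..1}" "norm (f x0) = max_norm f" by (rule max_norm_attained[OF cf])
  have mg: "max_norm g = \<bar>h (f x0)\<bar>"
  proof (rule antisym)
    show "max_norm g \<le> \<bar>h (f x0)\<bar>"
      unfolding max_norm_le_iff[OF cg] using le max_norm_le_iff[OF cf, of "max_norm f"] x0 g by auto
    show "\<bar>h (f x0)\<bar> \<le> max_norm g"
      using max_norm_le_iff[OF cg, of "max_norm g"] x0 g by auto
  qed
  show ext: "extremals g = extremals f"
    unfolding extremals_def mg using eq x0 g by auto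
  have sub: "extremals f \<subseteq> {-1..1}" by (auto simp: extremals_def)
  have pos: "max_norm g > 0" using mg z x0 f by (auto simp: equioscillating_def)
  have consec: "g b = - g a \<and> (\<exists>!x. x \<in> {a<..<b} \<and> g x = 0)"
    if "a \<in> extremals f" "b \<in> extremals f" "a < b \<and> extremals f \<inter> {a<..<b} = {}" for a b
  proof -
    have "f b = - f a" "\<exists>!x. x \<in> {a<..<b} \<and> f x = 0"
      using f that unfolding equioscillating_def by blast+
    moreover have ab: "a \<in> {-1..1}" "b \<in> {-1..1}" using that(1,2) sub by blast+
    have "x \<in> {a<..<b} \<and> g x = 0 \<longleftrightarrow> x \<in> {a<..<b} \<and> f x = 0" for x
    proof (cases "x \<in> {a<..<b}")
      case True
      then have "x \<in> {-1..1}" using ab by simp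
      then show ?thesis by (simp add: g z)
    qed auto
    moreover have "g a = h (f a)" "g b = h (f b)" using ab g by blast+
    ultimately show ?thesis by (simp add: odd)
  qed
  have f': "card (extremals f) = 2 * n + 2" "-1 \<in> extremals f" "1 \<in> extremals f"
    using f by (simp_all add: equioscillating_def)
  show "equioscillating n g"
    unfolding equioscillating_def ext
    by (rule conjI[OF pos conjI[OF cg conjI[OF f'(1) conjI[OF f'(2) conjI[OF f'(3)]]]]])
      (intro ballI impI consec)
qed

lemma equioscillating_sign:
  assumes f: "equioscillating n f" and "a \<in> extremals f"
  shows "f a = (-1) ^ card (extremals f \<inter> {a<..}) * f 1"
  using assms(2)
proof (induction "card (extremals f \<inter> {a<..})" arbitrary: a)
  case 0
  have "finite (extremals f)" using f by (auto simp: equioscillating_def intro: card_ge_0_finite)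
  then have "extremals f \<inter> {a<..} = {}" using 0(1) by simp
  moreover have "1 \<in> extremals f" using f by (simp add: equioscillating_def)
  moreover have "a \<le> 1" using 0(2) by (simp add: extremals_def)
  ultimately have "a = 1" by force
  then show ?case using 0(1) by simp
next
  case (Suc k)
  define B where "B = extremals f \<inter> {a<..}"
  have fin: "finite B" using Suc(2) by (intro card_ge_0_finite) (simp add: B_def)
  have ne: "B \<noteq> {}" using Suc(2) by (auto simp: B_def)
  define b where "b = Min B"
  have b: "b \<in> B" using fin ne by (simp add: b_def)
  have min: "b \<le> c" if "c \<in> B" for c using fin that by (simp add: b_def)
  have "B = insert b (extremals f \<inter> {b<..})" using b min by (force simp: B_def)
  then have "card B = Suc (card (extremals f \<inter> {b<..}))"
    using fin by (metis Int_iff card_insert_disjoint finite_insert greaterThan_iff less_irrefl)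
  then have k: "k = card (extremals f \<inter> {b<..})" using Suc(2) by (simp add: B_def)
  have "extremals f \<inter> {a<..<b} = {}" using min by (force simp: B_def)
  then have "f b = - f a" using f b Suc(3) unfolding equioscillating_def B_def by blast
  moreover have "f b = (-1) ^ card (extremals f \<inter> {b<..}) * f 1"
    using Suc(1)[OF k] b by (simp add: B_def)
  ultimately show ?case unfolding Suc(2)[symmetric] k [symmetric] by simp
qed

section \<open>Uniqueness\<close>

lemma prod_diff_sign:
  fixes a :: "'a::linordered_idom"
  assumes "finite A"
  shows "(-1) ^ card (A \<inter> {a<..}) * (\<Prod>b\<in>A - {a}. a - b) > 0"
proof -
  have "A - {a} = (A \<inter> {..<a}) \<union> (A \<inter> {a<..})" by auto
  then have "(\<Prod>b\<in>A - {a}. a - b) = (\<Prod>b\<in>A \<inter> {..<a}. a - b) * (\<Prod>b\<in>A \<inter> {a<..}. - (b - a))"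
    using assms by (simp add: prod.union_disjoint [symmetric] disjoint_iff)
  also have "(\<Prod>b\<in>A \<inter> {a<..}. - (b - a)) = (-1) ^ card (A \<inter> {a<..}) * (\<Prod>b\<in>A \<inter> {a<..}. b - a)"
    by (rule prod_uminus)
  finally have eq: "(-1) ^ card (A \<inter> {a<..}) * (\<Prod>b\<in>A - {a}. a - b)
      = ((-1) ^ card (A \<inter> {a<..}) * (-1) ^ card (A \<inter> {a<..}))
        * ((\<Prod>b\<in>A \<inter> {..<a}. a - b) * (\<Prod>b\<in>A \<inter> {a<..}. b - a))"
    by (simp only: mult_ac)
  have one: "(-1::'a) ^ card (A \<inter> {a<..}) * (-1) ^ card (A \<inter> {a<..}) = 1"
    by (simp flip: power_mult_distrib)
  have "(\<Prod>b\<in>A \<inter> {..<a}. a - b) * (\<Prod>b\<in>A \<inter> {a<..}. b - a) > 0"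
    by (intro mult_pos_pos prod_pos) auto
  then show ?thesis unfolding eq one by simp
qed

text \<open>By \<open>lagrange_leading_coeff\<close> the values at the \<open>2 n + 2\<close> extremal points, divided by the products
of node differences, sum to zero. These products alternate in sign as \<open>f\<close> does, so all terms have
the same sign and each of them vanishes, which leaves \<open>S\<close> with more roots than its degree allows.\<close>

lemma weak_alternation_zero:
  fixes S :: "complex poly" and D :: "real \<Rightarrow> real"
  assumes f: "equioscillating n f" and deg: "degree S \<le> 2 * n"
    and S: "\<And>x. poly S (complex_of_real x) = c * complex_of_real (D x)" and "c \<noteq> 0"
    and sgn: "\<And>x. x \<in> extremals f \<Longrightarrow> 0 \<le> f x * D x"
  shows "S = 0"
proof -
  define E where "E = extremals f"
  define W where "W x = (\<Prod>b\<in>E - {x}. x - b)" for x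
  define G where "G x = card (E \<inter> {x<..})" for x
  have card: "card E = 2 * n + 2" and fin: "finite E"
    using f by (auto simp: equioscillating_def E_def intro: card_ge_0_finite)
  have W: "(-1) ^ G x * W x > 0" for x unfolding G_def W_def by (rule prod_diff_sign[OF fin])
  have inj: "inj_on complex_of_real A" for A by (auto simp: inj_on_def)
  have ci: "card (complex_of_real ` E) = 2 * n + 2" using card by (simp add: card_image inj)
  have "(\<Sum>a\<in>complex_of_real ` E. poly S a / (\<Prod>b\<in>complex_of_real ` E - {a}. a - b)) = 0"
    using fin deg ci by (intro lagrange_leading_coeff) auto
  also have "(\<Sum>a\<in>complex_of_real ` E. poly S a / (\<Prod>b\<in>complex_of_real ` E - {a}. a - b))
     = (\<Sum>x\<in>E. c * complex_of_real (D x / W x))"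
  proof (subst sum.reindex[OF inj], rule sum.cong[OF refl])
    fix x assume "x \<in> E"
    have "complex_of_real ` E - {complex_of_real x} = complex_of_real ` (E - {x})" by auto
    then have "(\<Prod>b\<in>complex_of_real ` E - {complex_of_real x}. complex_of_real x - b) = complex_of_real (W x)"
      by (simp add: prod.reindex[OF inj] W_def)
    then show "((\<lambda>a. poly S a / (\<Prod>b\<in>complex_of_real ` E - {a}. a - b)) \<circ> complex_of_real) x
        = c * complex_of_real (D x / W x)"
      by (simp add: S)
  qed
  also have "\<dots> = c * complex_of_real (\<Sum>x\<in>E. D x / W x)" by (simp add: sum_distrib_left)
  finally have "complex_of_real (\<Sum>x\<in>E. D x / W x) = 0" using \<open>c \<noteq> 0\<close> by simp
  then have sum0: "(\<Sum>x\<in>E. D x / W x * f 1) = 0"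
    unfolding sum_distrib_right [symmetric] of_real_eq_0_iff by simp
  have f1: "f 1 \<noteq> 0"
    using f by (auto simp: equioscillating_def extremals_def)
  have terms: "D x / W x * f 1 = (f x * D x) / ((-1) ^ G x * W x)" if "x \<in> E" for x
  proof -
    have "f x = (-1) ^ G x * f 1" using equioscillating_sign[OF f] that by (simp add: E_def G_def)
    then show ?thesis by simp
  qed
  have nonneg: "0 \<le> D x / W x * f 1" if "x \<in> E" for x
    using sgn W[of x] that unfolding terms[OF that] by (intro divide_nonneg_pos) (auto simp: E_def)
  have "D x / W x * f 1 = 0" if "x \<in> E" for x
    using sum_nonneg_eq_0_iff[of E "\<lambda>x. D x / W x * f 1", OF fin nonneg] sum0 that by blast
  then have D0: "D x = 0" if "x \<in> E" for x
    using that f1 W[of x] by (metis divide_eq_0_iff less_irrefl mult_eq_0_iff)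
  show "S = 0"
    by (rule poly_eqI_degree[of "complex_of_real ` E"]) (use S D0 ci deg in auto)
qed

text \<open>At an extremal point the argument of \<open>w\<close> is at least as large in absolute value as that of
the competitor, so \<open>Im (w * cnj (twist \<omega> q))\<close> has the sign of the slope or vanishes, and
\<open>weak_alternation_zero\<close> applies. This gives \<open>p q\<^sup>\<dagger> = p\<^sup>\<dagger> q\<close>, and \<open>p\<close>, being coprime to \<open>p\<^sup>\<dagger>\<close> and of full
degree \<open>n\<close>, divides \<open>q\<close> with a constant quotient.\<close>

lemma best_poly_unique:
  assumes "0 < \<omega>" "\<omega> < (real n + 1) * pi" and best: "best_poly n \<omega> p"
    and q: "q \<noteq> 0" "degree q \<le> n" "tan_bounded \<omega> (best_tan n \<omega>) q"
    and Re_q: "\<And>x. x \<in> {-1..1} \<Longrightarrow> Re (twist \<omega> q x) \<ge> 0"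
  obtains c where "c > 0" "q = smult (complex_of_real c) p"
proof -
  note p = best_polyD[OF best]
  note eq = best_poly_equioscillating[OF assms(1,2) best]
  define M where "M = best_tan n \<omega>"
  define f where "f = slope \<omega> p"
  define D where "D x = Im (poly (p * pdagger q) (\<i> * complex_of_real x))" for x
  \<comment> \<open>Composition with \<open>\<i> x\<close> makes \<open>2 \<i> Im (p cnj q)\<close> a polynomial in the real variable \<open>x\<close>.\<close>
  define S where "S = (p * pdagger q - pdagger p * q) \<circ>\<^sub>p [:0, \<i>:]"
  have "degree (p * pdagger q - pdagger p * q) \<le> 2 * n"
    using p(1) q(2) by (intro degree_diff_le order_trans[OF degree_mult_le]) auto
  then have "degree S \<le> 2 * n" by (simp add: S_def degree_pcompose)
  moreover have "poly S (complex_of_real x) = (2 * \<i>) * complex_of_real (D x)" for x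
    by (simp add: S_def D_def poly_pcompose complex_eq_iff mult.commute)
  moreover have "0 \<le> f x * D x" if "x \<in> extremals f" for x
  proof -
    have x: "x \<in> {-1..1}" and fx: "\<bar>f x\<bar> = M" using that eq(3) by (auto simp: extremals_def f_def M_def)
    define r where "r = Re (twist \<omega> p x)"
    define a b where "a = Re (twist \<omega> q x)" and "b = Im (twist \<omega> q x)"
    have r: "r > 0" using p(5)[OF x] by (simp add: r_def)
    have im: "Im (twist \<omega> p x) = f x * r" using r by (simp add: f_def slope_def r_def)
    have D: "D x = r * (f x * a - b)"
      unfolding D_def Im_twist_mult_cnj [of \<omega>, symmetric] using im by (simp add: r_def a_def b_def algebra_simps)
    have "\<bar>b\<bar> \<le> M * \<bar>a\<bar>" using q(3) x unfolding tan_bounded_def M_def a_def b_def by blast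
    then have "\<bar>b\<bar> \<le> M * a" using Re_q[OF x] by (simp add: a_def)
    then have "f x * b \<le> M * (M * a)"
      using fx by (metis abs_ge_self abs_ge_zero abs_mult mult_left_mono order_trans)
    moreover have "f x * f x = M * M" using fx by (metis abs_mult_self_eq)
    then have "f x * (f x * a) = M * (M * a)" by (simp flip: mult.assoc)
    ultimately have "0 \<le> f x * (f x * a) - f x * b" by linarith
    then have "0 \<le> r * (f x * (f x * a) - f x * b)" using r by simp
    then show ?thesis by (simp add: D algebra_simps)
  qed
  ultimately have "S = 0"
    by (intro weak_alternation_zero[of n f S "2 * \<i>" D]) (use eq(1) in \<open>auto simp: f_def\<close>)
  then have "p * pdagger q - pdagger p * q = 0" unfolding S_def by (subst (asm) pcompose_eq_0_iff) auto
  then have cross: "p * pdagger q = pdagger p * q" by simp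
  then have "p dvd pdagger p * q" by (metis dvd_triv_left)
  then have "p dvd q" using p(2) by (simp add: coprime_dvd_mult_right_iff)
  then obtain c where c: "c \<noteq> 0" "q = smult c p"
    using same_degree_dvd_smult[of p q] q(1,2) eq(2) by auto
  have "smult (cnj c) (p * pdagger p) = smult c (p * pdagger p)"
    using cross by (simp add: c(2) pdagger_smult mult.commute)
  then have "smult (cnj c - c) (p * pdagger p) = 0" by (simp add: smult_diff_left)
  then have "cnj c = c" using p(3) by simp
  then have cr: "c = complex_of_real (Re c)" by (simp add: complex_eq_iff)
  have "Re (twist \<omega> q 0) = Re c * Re (twist \<omega> p 0)"
    unfolding c(2) twist_smult by (subst cr) simp
  then have "Re c * Re (twist \<omega> p 0) \<ge> 0" using Re_q[of 0] by simp
  then have "Re c \<ge> 0" using p(5)[of 0] by (simp add: zero_le_mult_iff)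
  moreover have "Re c \<noteq> 0" using c(1) cr by auto
  ultimately show ?thesis using that[of "Re c"] c(2) cr by simp
qed

section \<open>Phase functions\<close>

lemma cis_double_arctan: "cis (2 * arctan y) = (1 + \<i> * complex_of_real y) / (1 - \<i> * complex_of_real y)"
proof -
  define s where "s = sqrt (1 + y\<^sup>2)"
  have s: "s > 0" "s * s = 1 + y\<^sup>2" by (simp_all add: s_def add_pos_nonneg)
  have c: "cis (arctan y) = (1 + \<i> * complex_of_real y) / complex_of_real s"
    by (simp add: complex_eq_iff cos_arctan sin_arctan s_def)
  have n: "1 - \<i> * complex_of_real y \<noteq> 0" by (simp add: complex_eq_iff)
  have ss: "complex_of_real s * complex_of_real s = (1 + \<i> * complex_of_real y) * (1 - \<i> * complex_of_real y)"
    using s(2) by (simp add: complex_eq_iff power2_eq_square)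
  have "cis (2 * arctan y) = cis (arctan y) * cis (arctan y)" by (simp add: cis_mult)
  also have "\<dots> = (1 + \<i> * complex_of_real y) * (1 + \<i> * complex_of_real y) / (complex_of_real s * complex_of_real s)"
    by (simp add: c)
  also have "\<dots> = (1 + \<i> * complex_of_real y) / (1 - \<i> * complex_of_real y)"
    unfolding ss using n s(1) ss by (auto simp: divide_simps)
  finally show ?thesis .
qed

lemma cnj_over_self_eq_cis:
  assumes "Re w \<noteq> 0"
  shows "cnj w / w = cis (- 2 * arctan (Im w / Re w))"
proof -
  define y where "y = - (Im w / Re w)"
  have w: "w = complex_of_real (Re w) * (1 - \<i> * complex_of_real y)"
    "cnj w = complex_of_real (Re w) * (1 + \<i> * complex_of_real y)"
    using assms by (simp_all add: complex_eq_iff y_def)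
  have "cnj w / w = (1 + \<i> * complex_of_real y) / (1 - \<i> * complex_of_real y)"
    by (subst w(2), subst (2) w(1)) (use assms in simp)
  also have "\<dots> = cis (2 * arctan y)" by (rule cis_double_arctan [symmetric])
  also have "2 * arctan y = - 2 * arctan (Im w / Re w)" by (simp add: y_def arctan_minus)
  finally show ?thesis .
qed

text \<open>Each linear factor \<open>\<i> x - s\<close> contributes \<open>2 arctan ((x - Im s) / Re s)\<close> to the phase, and the
leading coefficient a constant.\<close>

lemma conjugate_quotient_phase:
  assumes "\<And>x. poly p (\<i> * complex_of_real x) \<noteq> 0"
  obtains \<theta> where "\<And>x. cnj (poly p (\<i> * complex_of_real x)) / poly p (\<i> * complex_of_real x)
     = cis (\<theta> + 2 * (\<Sum>s\<in>#proots p. arctan ((x - Im s) / Re s)))"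
proof -
  have p0: "p \<noteq> 0" using assms[of 0] by auto
  have quot_mult: "cnj (a * b) / (a * b) = (cnj a / a) * (cnj b / b)" for a b by simp
  define Q where "Q A = (\<Prod>s\<in>#A. [:- s, 1:])" for A :: "complex multiset"
  have Q: "cnj (poly (Q A) (\<i> * complex_of_real x)) / poly (Q A) (\<i> * complex_of_real x)
     = cis (2 * (\<Sum>s\<in>#A. arctan ((x - Im s) / Re s)))" if "\<forall>s\<in>#A. Re s \<noteq> 0" for A x
    using that
  proof (induction A)
    case empty
    then show ?case by (simp add: Q_def)
  next
    case (add s A)
    define z where "z = \<i> * complex_of_real x"
    have "Re (z - s) \<noteq> 0" using add.prems by (simp add: z_def)
    then have "cnj (z - s) / (z - s) = cis (2 * arctan ((x - Im s) / Re s))"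
      by (subst cnj_over_self_eq_cis) (simp_all add: z_def arctan_minus)
    moreover have "poly (Q (add_mset s A)) z = (z - s) * poly (Q A) z"
      by (simp add: Q_def algebra_simps)
    moreover have "cnj (poly (Q A) z) / poly (Q A) z = cis (2 * (\<Sum>s\<in>#A. arctan ((x - Im s) / Re s)))"
      using add by (simp add: z_def)
    ultimately have "cnj (poly (Q (add_mset s A)) z) / poly (Q (add_mset s A)) z
        = cis (2 * arctan ((x - Im s) / Re s)) * cis (2 * (\<Sum>s\<in>#A. arctan ((x - Im s) / Re s)))"
      by (simp only: quot_mult)
    then show ?case by (simp add: z_def cis_mult algebra_simps)
  qed
  have roots: "\<forall>s\<in>#proots p. Re s \<noteq> 0"
  proof
    fix s assume "s \<in># proots p"
    then have "poly p s = 0" using p0 by simp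
    moreover have "s = \<i> * complex_of_real (Im s)" if "Re s = 0"
      using that by (simp add: complex_eq_iff)
    ultimately show "Re s \<noteq> 0" using assms[of "Im s"] by metis
  qed
  define c where "c = lead_coeff p"
  have c0: "c \<noteq> 0" using p0 by (simp add: c_def)
  have p: "poly p z = c * poly (Q (proots p)) z" for z
    using arg_cong[OF complex_poly_decompose_multiset[of p], of "\<lambda>q. poly q z"] by (simp add: Q_def c_def)
  have "cnj c / c = cis (Arg (cnj c / c))" using c0 by (simp add: cis_Arg sgn_div_norm norm_divide)
  then have "cnj (poly p (\<i> * complex_of_real x)) / poly p (\<i> * complex_of_real x)
     = cis (Arg (cnj c / c)) * cis (2 * (\<Sum>s\<in>#proots p. arctan ((x - Im s) / Re s)))" for x
    unfolding p quot_mult Q[OF roots] by simp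
  then show ?thesis using that by (simp add: cis_mult)
qed

lemma continuous_on_arctan_sum:
  "continuous_on A (\<lambda>x. \<Sum>s\<in>#B. arctan ((x - Im s) / Re s))"
  unfolding divide_inverse by (induction B) (auto intro!: continuous_intros)

lemma cis_eq_cisD:
  assumes "cis a = cis b"
  obtains k :: int where "a = b + 2 * pi * k"
  using assms sin_cos_eq_iff[of a b] by (auto simp: complex_eq_iff)

text \<open>Errors below \<open>2\<close> correspond to tangents by the increasing function
\<open>M \<mapsto> 2 M / sqrt (1 + M\<^sup>2)\<close>, so the minimisers of the error are the fractions of the minimisers of
the tangent.\<close>

lemma best_approx_eq:
  assumes \<omega>: "0 < \<omega>" "\<omega> < (real n + 1) * pi" and best: "best_poly n \<omega> p"
  shows "best_approx n \<omega> = Fraction_Field.Fract (pdagger p) p"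
  unfolding best_approx_def
proof (rule the_equality, intro conjI ballI)
  note p = best_polyD[OF best]
  define M where "M = best_tan n \<omega>"
  define err where "err q = approx_error \<omega> (Fraction_Field.Fract (pdagger q) q)" for q
  have M0: "M \<ge> 0" using best_tan_attained(1)[OF \<omega>] by (simp add: M_def)
  have err_p: "err p \<le> 2 * M / sqrt (1 + M\<^sup>2)"
    using approx_error_le_tan_bounded[OF p(2) M0] p(4) by (simp add: err_def M_def)
  show "Fraction_Field.Fract (pdagger p) p \<in> unitary_rat n"
    using p(1,2) by (auto simp: unitary_rat_coprime)
  fix u assume "u \<in> unitary_rat n"
  then obtain q where q: "u = Fraction_Field.Fract (pdagger q) q" "degree q \<le> n" "coprime q (pdagger q)"
    by (auto simp: unitary_rat_coprime)
  have e0: "err q \<ge> 0" using approx_error_nonneg[OF q(3)] by (simp add: err_def)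
  have "err p \<le> err q"
  proof (cases "err q < 2")
    case True
    define s where "s = sqrt (4 - (err q)\<^sup>2)"
    \<comment> \<open>The tangent that corresponds to the error of \<open>q\<close>.\<close>
    define M' where "M' = err q / s"
    have "(err q)\<^sup>2 < 2\<^sup>2" using True e0 by (intro power_strict_mono) auto
    then have s: "s > 0" "s\<^sup>2 = 4 - (err q)\<^sup>2" by (simp_all add: s_def)
    have M'0: "M' \<ge> 0" using e0 s by (simp add: M'_def)
    have "1 + M'\<^sup>2 = (2 / s)\<^sup>2" using s by (simp add: M'_def power_divide field_simps)
    then have "sqrt (1 + M'\<^sup>2) = 2 / s" using s(1) by simp
    then have f: "2 * M' / sqrt (1 + M'\<^sup>2) = err q" using s(1) by (simp add: M'_def)
    then have "tan_bounded \<omega> M' q"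
      using approx_error_le_tan_bounded[OF q(3) M'0, of \<omega>] by (simp add: err_def)
    then have "M \<le> M'" unfolding M_def
      using M'0 q(2,3) coprime_pdagger_nonzero by (intro best_tan_le) auto
    then have "tan_bounded \<omega> M' p"
      using p(4) unfolding tan_bounded_def M_def by (meson abs_ge_zero mult_right_mono order_trans)
    then show ?thesis
      using approx_error_le_tan_bounded[OF p(2) M'0, of \<omega>] f by (simp add: err_def)
  next
    case False
    have "2 * M / sqrt (1 + M\<^sup>2) \<le> 2"
      using M0 real_le_rsqrt[of M "1 + M\<^sup>2"] by (simp add: divide_le_eq add_pos_nonneg)
    then show ?thesis using False err_p by linarith
  qed
  then show "approx_error \<omega> (Fraction_Field.Fract (pdagger p) p) \<le> approx_error \<omega> u"
    by (simp add: err_def q(1))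
next
  note p = best_polyD[OF best]
  define M where "M = best_tan n \<omega>"
  have M0: "M \<ge> 0" using best_tan_attained(1)[OF \<omega>] by (simp add: M_def)
  fix r assume r: "r \<in> unitary_rat n \<and> (\<forall>u\<in>unitary_rat n. approx_error \<omega> r \<le> approx_error \<omega> u)"
  then obtain q where q: "r = Fraction_Field.Fract (pdagger q) q" "degree q \<le> n" "coprime q (pdagger q)"
    by (auto simp: unitary_rat_coprime)
  have "Fraction_Field.Fract (pdagger p) p \<in> unitary_rat n"
    using p(1,2) by (auto simp: unitary_rat_coprime)
  then have "approx_error \<omega> r \<le> approx_error \<omega> (Fraction_Field.Fract (pdagger p) p)" using r by blast
  also have "\<dots> \<le> 2 * M / sqrt (1 + M\<^sup>2)"
    using approx_error_le_tan_bounded[OF p(2) M0] p(4) by (simp add: M_def)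
  finally have "tan_bounded \<omega> M q"
    using approx_error_le_tan_bounded[OF q(3) M0] by (simp add: q(1))
  then have "best_poly n \<omega> q \<or> best_poly n \<omega> (- q)"
    using best_poly_of_tan_bounded q by (simp add: M_def)
  then obtain q' where q': "best_poly n \<omega> q'" "q' = q \<or> q' = - q" by blast
  note bq = best_polyD[OF q'(1)]
  obtain c where c: "c > 0" "q' = smult (complex_of_real c) p"
    by (rule best_poly_unique[OF \<omega> best bq(3,1,4)]) (use bq(5) in \<open>auto intro: less_imp_le\<close>)
  have "\<exists>c. c \<noteq> 0 \<and> q = smult (complex_of_real c) p"
    using q'(2) c by (auto intro: exI[of _ c] exI[of _ "- c"])
  then obtain c' where c': "c' \<noteq> 0" "q = smult (complex_of_real c') p" by blast
  then show "r = Fraction_Field.Fract (pdagger p) p"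
    using p(3) by (simp add: q(1) eq_fract pdagger_smult mult.commute)
qed

text \<open>Two phase functions differ by a constant multiple of \<open>2 \<pi>\<close>, and both have modulus below \<open>\<pi>\<close>
at \<open>0\<close>.\<close>

lemma is_phase_function_unique:
  assumes g: "is_phase_function \<omega> r g" and h: "is_phase_function \<omega> r h"
  shows "g = h"
proof -
  define S where "S x = 2 * (\<Sum>s\<in>#proots (rat_den r). arctan ((x - Im s) / Re s))" for x
  have cS: "continuous_on A S" for A
    unfolding S_def by (intro continuous_intros continuous_on_arctan_sum)
  have bound: "\<bar>f 0\<bar> < pi" if "is_phase_function \<omega> r f" for f
  proof -
    from that obtain \<theta> where f: "\<And>x. f x = \<theta> + S x" "max_norm (\<lambda>x. f x - \<omega> * x) < pi"
      by (auto simp: is_phase_function_def S_def)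
    have "continuous_on {-1..1} (\<lambda>x. f x - \<omega> * x)" unfolding f(1) by (intro continuous_intros cS)
    from max_norm_le_iff[OF this, of "max_norm (\<lambda>x. f x - \<omega> * x)"]
    have "\<forall>x\<in>{-1..1}. norm (f x - \<omega> * x) \<le> max_norm (\<lambda>x. f x - \<omega> * x)" by blast
    then have "norm (f 0 - \<omega> * 0) \<le> max_norm (\<lambda>x. f x - \<omega> * x)" by (rule bspec) simp
    then have "\<bar>f 0\<bar> \<le> max_norm (\<lambda>x. f x - \<omega> * x)" by simp
    then show ?thesis using f(2) by linarith
  qed
  from g h obtain \<theta> \<theta>' where gh: "\<And>x. g x = \<theta> + S x" "\<And>x. h x = \<theta>' + S x"
    by (auto simp: is_phase_function_def S_def)
  have "cis (g 0) = cis (h 0)" using g h unfolding is_phase_function_def cis_conv_exp by metis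
  then obtain k :: int where k: "g 0 = h 0 + 2 * pi * k" by (rule cis_eq_cisD)
  have "\<bar>2 * pi * k\<bar> < 2 * pi" using k bound[OF g] bound[OF h] by linarith
  then have "k = 0" by (simp add: abs_mult)
  then have "\<theta> = \<theta>'" using k gh by simp
  then show ?thesis using gh by auto
qed

text \<open>The sum of arctangents, corrected by \<open>\<omega> x\<close>, and \<open>- 2 arctan (slope \<omega> p x)\<close> are continuous
arguments of the same quotient, so they differ by a constant multiple of \<open>2 \<pi>\<close>, which is absorbed
into the free constant of the phase function.\<close>

lemma phase_error_eq:
  assumes \<omega>: "0 < \<omega>" "\<omega> < (real n + 1) * pi" and best: "best_poly n \<omega> p" and x: "x \<in> {-1..1}"
  shows "phase_error n \<omega> x = - 2 * arctan (slope \<omega> p x)"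
proof -
  note p = best_polyD[OF best]
  define r where "r = Fraction_Field.Fract (pdagger p) p"
  define S where "S x = 2 * (\<Sum>s\<in>#proots p. arctan ((x - Im s) / Re s))" for x
  define \<phi> where "\<phi> x = - 2 * arctan (slope \<omega> p x)" for x
  have cS: "continuous_on A S" for A
    unfolding S_def by (intro continuous_intros continuous_on_arctan_sum)
  have Re0: "Re (twist \<omega> p x) \<noteq> 0" if "x \<in> {-1..1}" for x using p(5)[OF that] by simp
  have c\<phi>: "continuous_on {-1..1} \<phi>"
    unfolding \<phi>_def by (intro continuous_intros continuous_on_slope Re0)
  have pr: "proots (rat_den r) = proots p"
    by (rule rat_num_den_Fract[OF p(2)]) (metis proots_smult r_def)
  obtain \<theta> where \<theta>: "\<And>x. cnj (poly p (\<i> * complex_of_real x)) / poly p (\<i> * complex_of_real x)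
     = cis (\<theta> + S x)"
    unfolding S_def using conjugate_quotient_phase[OF coprime_pdagger_no_imaginary_root[OF p(2)]] by blast
  have ev: "rat_eval r (\<i> * complex_of_real x) = cis (\<theta> + S x)" for x
    unfolding r_def rat_eval_Fract[OF p(2)] by (rule \<theta>)
  have per: "\<exists>k::int. \<theta> + S x - \<omega> * x - \<phi> x = 2 * pi * k" if "x \<in> {-1..1}" for x
  proof -
    have "cis (\<theta> + S x) = cis (\<phi> x) * cis (\<omega> * x)"
      using ev[of x] rat_eval_eq_twist[OF p(2), of x \<omega>] cnj_over_self_eq_cis[OF Re0[OF that]]
      by (simp add: r_def \<phi>_def slope_def)
    then have "cis (\<theta> + S x) = cis (\<phi> x + \<omega> * x)" by (simp add: cis_mult)
    then obtain k :: int where "\<theta> + S x = \<phi> x + \<omega> * x + 2 * pi * k" by (rule cis_eq_cisD)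
    then show ?thesis by (intro exI[of _ k]) simp
  qed
  define F where "F x = \<theta> + S x - \<omega> * x - \<phi> x" for x
  have "F constant_on {-1..1}"
  proof (rule continuous_discrete_range_constant)
    show "continuous_on {-1..1} F" unfolding F_def by (intro continuous_intros cS c\<phi>)
    fix a :: real assume a: "a \<in> {-1..1}"
    \<comment> \<open>The values of \<open>F\<close> are integer multiples of \<open>2 \<pi>\<close>, so distinct ones are far apart.\<close>
    have "2 * pi \<le> norm (F b - F a)" if b: "b \<in> {-1..1} \<and> F b \<noteq> F a" for b
    proof -
      obtain k l :: int where kl: "F a = 2 * pi * k" "F b = 2 * pi * l"
        using per[OF a] per[of b] b by (auto simp: F_def)
      then have "\<bar>l - k\<bar> \<ge> 1" using b by auto
      then have "1 \<le> \<bar>real_of_int l - real_of_int k\<bar>" by linarith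
      then have "2 * pi * 1 \<le> 2 * pi * \<bar>real_of_int l - real_of_int k\<bar>" by (intro mult_left_mono) auto
      also have "\<dots> = norm (F b - F a)" by (simp add: kl abs_mult flip: right_diff_distrib)
      finally show ?thesis by simp
    qed
    then show "\<exists>e>0. \<forall>b. b \<in> {-1..1} \<and> F b \<noteq> F a \<longrightarrow> e \<le> norm (F b - F a)"
      by (intro exI[of _ "2 * pi"]) auto
  qed auto
  then obtain d where d: "\<And>x. x \<in> {-1..1} \<Longrightarrow> F x = d" by (auto simp: constant_on_def)
  obtain k :: int where k: "d = 2 * pi * k" using per[of 0] d[of 0] by (auto simp: F_def)
  define g where "g x = \<theta> - d + S x" for x
  have g\<phi>: "g x - \<omega> * x = \<phi> x" if "x \<in> {-1..1}" for x using d[OF that] by (simp add: F_def g_def)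
  have cg: "continuous_on {-1..1} (\<lambda>x. g x - \<omega> * x)" unfolding g_def by (intro continuous_intros cS)
  have "is_phase_function \<omega> r g"
    unfolding is_phase_function_def
  proof (intro conjI allI)
    show "\<exists>\<theta>. \<forall>x. g x = \<theta> + 2 * (\<Sum>s\<in>#proots (rat_den r). arctan ((x - Im s) / Re s))"
      unfolding pr by (intro exI[of _ "\<theta> - d"]) (simp add: g_def S_def)
    fix x
    have "cis (\<theta> + S x) = cis (g x) * cis d" by (simp add: cis_mult g_def)
    also have "cis d = 1" by (simp add: k complex_eq_iff)
    finally show "rat_eval r (\<i> * complex_of_real x) = exp (\<i> * complex_of_real (g x))"
      by (simp add: ev cis_conv_exp)
  next
    obtain y where y: "y \<in> {-1..1}" "norm (g y - \<omega> * y) = max_norm (\<lambda>x. g x - \<omega> * x)"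
      by (rule max_norm_attained[OF cg])
    have "\<bar>\<phi> y\<bar> < pi" using arctan_bounded[of "slope \<omega> p y"] by (auto simp: \<phi>_def abs_less_iff)
    then show "max_norm (\<lambda>x. g x - \<omega> * x) < pi" using y g\<phi> by simp
  qed
  then have "phase_function \<omega> r = g"
    unfolding phase_function_def by (intro the_equality) (auto intro: is_phase_function_unique)
  then show ?thesis
    using g\<phi>[OF x] by (simp add: phase_error_def best_approx_eq[OF \<omega> best] r_def \<phi>_def)
qed

lemma phase_error_equioscillating:
  assumes \<omega>: "0 < \<omega>" "\<omega> < (real n + 1) * pi"
  shows "equioscillating n (phase_error n \<omega>)"
proof -
  obtain p where best: "best_poly n \<omega> p" using best_poly_exists[OF \<omega>] by blast
  show ?thesis
  proof (rule equioscillating_compose(1)[OF best_poly_equioscillating(1)[OF \<omega> best]])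
    fix s t :: real assume st: "\<bar>s\<bar> < \<bar>t\<bar>"
    have abs: "\<bar>arctan u\<bar> = arctan \<bar>u\<bar>" for u by (simp add: abs_if arctan_minus)
    show "\<bar>- 2 * arctan s\<bar> < \<bar>- 2 * arctan t\<bar>" using st by (simp add: abs_mult abs arctan_less_iff)
  qed (auto simp: phase_error_eq[OF \<omega> best] arctan_minus intro!: continuous_intros)
qed

section \<open>Joint continuity of the phase error\<close>

text \<open>The subsequence principle, through which compactness and uniqueness yield convergence.\<close>

lemma LIMSEQ_if_subseq:
  fixes X :: "nat \<Rightarrow> 'a::metric_space"
  assumes "\<And>r :: nat \<Rightarrow> nat. strict_mono r \<Longrightarrow> \<exists>s :: nat \<Rightarrow> nat. strict_mono s \<and> (\<lambda>k. X (r (s k))) \<longlonglongrightarrow> l"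
  shows "X \<longlonglongrightarrow> l"
proof (rule ccontr)
  assume "\<not> X \<longlonglongrightarrow> l"
  then obtain e where e: "e > 0" "\<not> (\<exists>N. \<forall>k\<ge>N. dist (X k) l < e)"
    by (auto simp: lim_sequentially)
  then have "infinite {k. dist (X k) l \<ge> e}"
    unfolding infinite_nat_iff_unbounded_le by (metis mem_Collect_eq not_less)
  then obtain r :: "nat \<Rightarrow> nat" where r: "strict_mono r" "\<And>k. dist (X (r k)) l \<ge> e"
    using infinite_enumerate by (metis mem_Collect_eq)
  obtain s where "(\<lambda>k. X (r (s k))) \<longlonglongrightarrow> l" using assms[OF r(1)] by blast
  then obtain k where "dist (X (r (s k))) l < e" using e(1) by (metis lim_sequentially order_refl)
  then show False using r(2)[of "s k"] by simp
qed

text \<open>The minimiser for \<open>\<omega>\<close> satisfies the bound with \<open>e\<close> added strictly on the compact interval, hence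
also for nearby frequencies.\<close>

lemma best_tan_upper_semicontinuous:
  assumes \<omega>: "0 < \<omega>" "\<omega> < (real n + 1) * pi" and "e > 0"
  shows "eventually (\<lambda>\<omega>'. best_tan n \<omega>' \<le> best_tan n \<omega> + e) (nhds \<omega>)"
proof -
  obtain p where best: "best_poly n \<omega> p" using best_poly_exists[OF \<omega>] by blast
  note p = best_polyD[OF best]
  define M where "M = best_tan n \<omega> + e"
  have M0: "M \<ge> 0" using best_tan_attained(1)[OF \<omega>] \<open>e > 0\<close> by (simp add: M_def)
  define W where "W = {z. 0 < M * \<bar>Re (twist (fst z) p (snd z))\<bar> - \<bar>Im (twist (fst z) p (snd z))\<bar>}"
  have "open W" unfolding W_def
    by (intro open_Collect_less continuous_intros)
  moreover have "{\<omega>} \<times> {-1..1} \<subseteq> W"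
  proof
    fix z assume "z \<in> {\<omega>} \<times> {-1..1::real}"
    then obtain x where z: "z = (\<omega>, x)" and x: "x \<in> {-1..1}" by auto
    have "\<bar>Im (twist \<omega> p x)\<bar> \<le> best_tan n \<omega> * \<bar>Re (twist \<omega> p x)\<bar>"
      using p(4) x unfolding tan_bounded_def by blast
    moreover have "0 < e * \<bar>Re (twist \<omega> p x)\<bar>" using \<open>e > 0\<close> p(5)[OF x] by simp
    ultimately show "z \<in> W" by (simp add: W_def z M_def ring_distribs)
  qed
  ultimately obtain X where X: "\<omega> \<in> X" "open X" "X \<times> {-1..1} \<subseteq> W"
    using Elementary_Topology.tube_lemma[of "{-1..1::real}" W \<omega>] by auto
  have "best_tan n \<omega>' \<le> M" if "\<omega>' \<in> X" for \<omega>'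
  proof (rule best_tan_le[OF M0 p(3) p(1)])
    show "tan_bounded \<omega>' M p" unfolding tan_bounded_def
    proof
      fix x assume "x \<in> {-1..1::real}"
      then have "(\<omega>', x) \<in> W" using X(3) that by blast
      then show "\<bar>Im (twist \<omega>' p x)\<bar> \<le> M * \<bar>Re (twist \<omega>' p x)\<bar>" by (simp add: W_def)
    qed
  qed
  then show ?thesis using X(1,2) unfolding eventually_nhds M_def by blast
qed

text \<open>A limit \<open>q\<close> of the scaled best polynomials satisfies the minimal bound at \<open>\<omega>\<close> and has twist with
nonnegative real part, so it is a positive multiple of the best polynomial \<open>p\<close>. As the twist
of \<open>p\<close> has no zero on \<open>[-1,1]\<close>, the quotients of imaginary and real part converge.\<close>

lemma phase_error_limit_subseq:
  fixes \<Omega> x :: "nat \<Rightarrow> real"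
  assumes \<Omega>: "\<And>k. \<Omega> k \<in> {0<..<(real n + 1) * pi}" and \<omega>: "\<omega> \<in> {0<..<(real n + 1) * pi}"
    and lim: "\<Omega> \<longlonglongrightarrow> \<omega>" and x: "\<And>k. x k \<in> {-1..1}" "x \<longlonglongrightarrow> y"
  shows "\<exists>s :: nat \<Rightarrow> nat. strict_mono s \<and>
     (\<lambda>k. phase_error n (\<Omega> (s k)) (x (s k))) \<longlonglongrightarrow> phase_error n \<omega> y"
proof -
  have \<Omega>': "0 < \<Omega> k" "\<Omega> k < (real n + 1) * pi" for k using \<Omega>[of k] by auto
  have \<omega>': "0 < \<omega>" "\<omega> < (real n + 1) * pi" using \<omega> by auto
  have y: "y \<in> {-1..1}" by (rule closed_sequentially[OF _ _ x(2)]) (use x(1) in auto)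
  obtain P where P: "\<And>k. best_poly n (\<Omega> k) (P k)" using best_poly_exists[OF \<Omega>'] by metis
  obtain p where p: "best_poly n \<omega> p" using best_poly_exists[OF \<omega>'] by metis
  obtain s :: "nat \<Rightarrow> nat" and c :: "nat \<Rightarrow> real" and q where s: "strict_mono s" and c: "\<And>k. c k > 0"
    and q: "q \<noteq> 0" "degree q \<le> n"
    and tw: "\<And>x l. x \<longlonglongrightarrow> l \<Longrightarrow> (\<lambda>k. complex_of_real (c k) * twist (\<Omega> (s k)) (P (s k)) (x k)) \<longlonglongrightarrow> twist \<omega> q l"
    using twist_sequence_compact[of P n, OF best_polyD(1)[OF P] best_polyD(3)[OF P] lim] by blast
  \<comment> \<open>Taking the maximum with \<open>M\<close> turns the upper bound for the minimal tangents into convergence, while the bounds \<open>L k\<close> stay valid.\<close>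
  define M where "M = best_tan n \<omega>"
  define L where "L k = max (best_tan n (\<Omega> (s k))) M" for k
  have "L \<longlonglongrightarrow> M"
  proof (rule LIMSEQ_I)
    fix e :: real assume e: "e > 0"
    have "(\<lambda>k. \<Omega> (s k)) \<longlonglongrightarrow> \<omega>" using LIMSEQ_subseq_LIMSEQ[OF lim s] by (simp add: o_def)
    moreover have "eventually (\<lambda>\<omega>'. best_tan n \<omega>' \<le> M + e / 2) (nhds \<omega>)"
      unfolding M_def using e by (intro best_tan_upper_semicontinuous \<omega>') simp
    ultimately have "eventually (\<lambda>k. best_tan n (\<Omega> (s k)) \<le> M + e / 2) sequentially"
      by (rule eventually_compose_filterlim [rotated])
    then obtain N where N: "\<And>k. k \<ge> N \<Longrightarrow> best_tan n (\<Omega> (s k)) \<le> M + e / 2"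
      unfolding eventually_sequentially by blast
    then show "\<exists>N. \<forall>k\<ge>N. norm (L k - M) < e"
    proof (intro exI[of _ N] allI impI)
      fix k assume "N \<le> k"
      then show "norm (L k - M) < e" using N[of k] e by (auto simp: L_def max_def)
    qed
  qed
  moreover have "tan_bounded (\<Omega> (s k)) (L k) (P (s k))" for k
    unfolding tan_bounded_def
  proof
    fix x assume "x \<in> {-1..1::real}"
    then have "\<bar>Im (twist (\<Omega> (s k)) (P (s k)) x)\<bar> \<le> best_tan n (\<Omega> (s k)) * \<bar>Re (twist (\<Omega> (s k)) (P (s k)) x)\<bar>"
      using best_polyD(4)[OF P] unfolding tan_bounded_def by blast
    also have "\<dots> \<le> L k * \<bar>Re (twist (\<Omega> (s k)) (P (s k)) x)\<bar>"
      by (intro mult_right_mono) (auto simp: L_def)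
    finally show "\<bar>Im (twist (\<Omega> (s k)) (P (s k)) x)\<bar> \<le> L k * \<bar>Re (twist (\<Omega> (s k)) (P (s k)) x)\<bar>" .
  qed
  ultimately have tq: "tan_bounded \<omega> M q"
    using tan_bounded_limit[where c = c and \<Omega> = "\<lambda>k. \<Omega> (s k)" and p = "\<lambda>k. P (s k)" and L = L] tw by blast
  have Re_q: "Re (twist \<omega> q z) \<ge> 0" if z: "z \<in> {-1..1}" for z
  proof -
    have "(\<lambda>k. Re (complex_of_real (c k) * twist (\<Omega> (s k)) (P (s k)) z)) \<longlonglongrightarrow> Re (twist \<omega> q z)"
      by (intro tendsto_Re tw tendsto_const)
    moreover have "Re (complex_of_real (c k) * twist (\<Omega> (s k)) (P (s k)) z) \<ge> 0" for k
      using c[of k] best_polyD(5)[OF P z, of "s k"] by simp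
    ultimately show ?thesis by (intro LIMSEQ_le_const) auto
  qed
  obtain b where b: "b > 0" "q = smult (complex_of_real b) p"
    using best_poly_unique[OF \<omega>' p q tq[unfolded M_def] Re_q] by blast
  have "(\<lambda>k. complex_of_real (c k) * twist (\<Omega> (s k)) (P (s k)) (x (s k))) \<longlonglongrightarrow> twist \<omega> q y"
    using tw[OF LIMSEQ_subseq_LIMSEQ[OF x(2) s]] by (simp add: o_def)
  moreover have rq: "Re (twist \<omega> q y) \<noteq> 0"
    using best_polyD(5)[OF p y] b(1) by (simp add: b(2) twist_smult)
  ultimately have "(\<lambda>k. Im (complex_of_real (c k) * twist (\<Omega> (s k)) (P (s k)) (x (s k)))
      / Re (complex_of_real (c k) * twist (\<Omega> (s k)) (P (s k)) (x (s k))))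
      \<longlonglongrightarrow> Im (twist \<omega> q y) / Re (twist \<omega> q y)"
    by (intro tendsto_intros)
  also have "(\<lambda>k. Im (complex_of_real (c k) * twist (\<Omega> (s k)) (P (s k)) (x (s k)))
      / Re (complex_of_real (c k) * twist (\<Omega> (s k)) (P (s k)) (x (s k))))
      = (\<lambda>k. slope (\<Omega> (s k)) (P (s k)) (x (s k)))"
  proof
    fix k
    show "Im (complex_of_real (c k) * twist (\<Omega> (s k)) (P (s k)) (x (s k)))
      / Re (complex_of_real (c k) * twist (\<Omega> (s k)) (P (s k)) (x (s k)))
      = slope (\<Omega> (s k)) (P (s k)) (x (s k))" using c[of k] by (simp add: slope_def)
  qed
  also have "Im (twist \<omega> q y) / Re (twist \<omega> q y) = slope \<omega> p y"
    using b(1) by (simp add: slope_def b(2) twist_smult)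
  finally have "(\<lambda>k. - 2 * arctan (slope (\<Omega> (s k)) (P (s k)) (x (s k)))) \<longlonglongrightarrow> - 2 * arctan (slope \<omega> p y)"
    by (intro tendsto_intros)
  then show ?thesis
    using s by (simp add: phase_error_eq[OF \<Omega>' P x(1)] phase_error_eq[OF \<omega>' p y]) blast
qed

lemma phase_error_tendsto:
  fixes \<Omega> x :: "nat \<Rightarrow> real"
  assumes "\<And>k. \<Omega> k \<in> {0<..<(real n + 1) * pi}" "\<omega> \<in> {0<..<(real n + 1) * pi}"
    and "\<Omega> \<longlonglongrightarrow> \<omega>" "\<And>k. x k \<in> {-1..1}" "x \<longlonglongrightarrow> y"
  shows "(\<lambda>k. phase_error n (\<Omega> k) (x k)) \<longlonglongrightarrow> phase_error n \<omega> y"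
proof (rule LIMSEQ_if_subseq)
  fix r :: "nat \<Rightarrow> nat" assume r: "strict_mono r"
  show "\<exists>s. strict_mono s \<and> (\<lambda>k. phase_error n (\<Omega> (r (s k))) (x (r (s k)))) \<longlonglongrightarrow> phase_error n \<omega> y"
    using phase_error_limit_subseq[of "\<lambda>k. \<Omega> (r k)" n \<omega> "\<lambda>k. x (r k)" y] assms
      LIMSEQ_subseq_LIMSEQ[OF assms(3) r] LIMSEQ_subseq_LIMSEQ[OF assms(5) r] by (simp add: o_def)
qed

section \<open>Continuity of the extremal points and zeros\<close>

lemma equioscillating_list:
  assumes f: "equioscillating n f"
  defines "L \<equiv> sorted_list_of_set (extremals f)"
  shows "length L = 2 * n + 2" "sorted_wrt (<) L" "set L = extremals f" "hd L = -1" "last L = 1"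
    "\<And>j. j < 2 * n + 1 \<Longrightarrow> L ! j < L ! Suc j \<and> f (L ! Suc j) = - f (L ! j) \<and>
        (\<exists>!x. x \<in> {L ! j<..<L ! Suc j} \<and> f x = 0)"
    "\<And>j. j < 2 * n + 2 \<Longrightarrow> L ! j \<in> {-1..1} \<and> \<bar>f (L ! j)\<bar> = max_norm f"
proof -
  have fin: "finite (extremals f)" using f by (auto simp: equioscillating_def intro: card_ge_0_finite)
  show len: "length L = 2 * n + 2" using f by (simp add: L_def equioscillating_def)
  show srt: "sorted_wrt (<) L" by (simp add: L_def)
  show set: "set L = extremals f" using fin by (simp add: L_def)
  show mem: "L ! j \<in> {-1..1} \<and> \<bar>f (L ! j)\<bar> = max_norm f" if "j < 2 * n + 2" for j
  proof -
    have "L ! j \<in> extremals f" using that len by (simp flip: set)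
    then show ?thesis by (simp add: extremals_def)
  qed
  have mono: "L ! i < L ! j" if "i < j" "j < 2 * n + 2" for i j
    using sorted_wrt_nth_less[OF srt that(1)] that(2) len by simp
  have "-1 \<in> set L" "1 \<in> set L" using f by (simp_all add: set equioscillating_def)
  then obtain i j where i: "i < 2 * n + 2" "L ! i = -1" and j: "j < 2 * n + 2" "L ! j = 1"
    by (metis in_set_conv_nth len)
  have "i = 0" using mono[of 0 i] i mem[of 0] by (cases i) auto
  then show "hd L = -1" using i len by (subst hd_conv_nth) auto
  have "j = 2 * n + 1" using mono[of j "2 * n + 1"] j mem[of "2 * n + 1"] by (cases "j < 2 * n + 1") auto
  then show "last L = 1" using j len by (subst last_conv_nth) auto
  fix j assume j: "j < 2 * n + 1"
  have "extremals f \<inter> {L ! j<..<L ! Suc j} = {}"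
  proof (rule ccontr)
    assume "extremals f \<inter> {L ! j<..<L ! Suc j} \<noteq> {}"
    then obtain i where i: "i < 2 * n + 2" "L ! j < L ! i" "L ! i < L ! Suc j"
      unfolding set [symmetric] by (auto simp: in_set_conv_nth len)
    have "\<not> i < j" using mono[of i j] i j by auto
    moreover have "\<not> Suc j < i" using mono[of "Suc j" i] i by auto
    moreover have "i \<noteq> j" "i \<noteq> Suc j" using i by auto
    ultimately show False by linarith
  qed
  moreover have "L ! j \<in> extremals f" "L ! Suc j \<in> extremals f" using j len by (simp_all flip: set)
  moreover have "L ! j < L ! Suc j" using mono[of j "Suc j"] j by simp
  ultimately show "L ! j < L ! Suc j \<and> f (L ! Suc j) = - f (L ! j) \<and>
        (\<exists>!x. x \<in> {L ! j<..<L ! Suc j} \<and> f x = 0)"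
    using f unfolding equioscillating_def by blast
qed

text \<open>All \<open>2 n + 2\<close> points converge along a common subsequence. The limits are extremal for \<open>f\<close>, and
neighbouring limits are distinct since \<open>f\<close> takes opposite nonzero values there; counting
identifies them with the extremal points of \<open>f\<close> in order.\<close>

lemma extremal_tendsto:
  fixes \<phi> :: "nat \<Rightarrow> real \<Rightarrow> real"
  assumes \<phi>: "\<And>k. equioscillating n (\<phi> k)" and f: "equioscillating n f"
    and conv: "\<And>(s :: nat \<Rightarrow> nat) x l. strict_mono s \<Longrightarrow> (\<And>k. x k \<in> {-1..1}) \<Longrightarrow> x \<longlonglongrightarrow> l
      \<Longrightarrow> (\<lambda>k. \<phi> (s k) (x k)) \<longlonglongrightarrow> f l"
    and j: "j < 2 * n + 2"
  shows "(\<lambda>k. sorted_list_of_set (extremals (\<phi> k)) ! j) \<longlonglongrightarrow> sorted_list_of_set (extremals f) ! j"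
proof (rule LIMSEQ_if_subseq)
  fix r :: "nat \<Rightarrow> nat" assume r: "strict_mono r"
  define L where "L k = sorted_list_of_set (extremals (\<phi> k))" for k
  note L = equioscillating_list[OF \<phi>, folded L_def]
  have cont: "continuous_on {-1..1} f" "\<And>k. continuous_on {-1..1} (\<phi> k)" and pos: "max_norm f > 0"
    using f \<phi> by (simp_all add: equioscillating_def)
  have "\<exists>l s. strict_mono s \<and> (\<forall>i. l i \<in> {-1..1} \<and>
      (\<lambda>k. if i < 2 * n + 2 then L (r (s k)) ! i else 0) \<longlonglongrightarrow> l i)"
    by (rule coordinatewise_subseq[where a = "\<lambda>k i. if i < 2 * n + 2 then L (r k) ! i else 0"])
      (use L(7) in auto)
  then obtain l s where s: "strict_mono s" and l: "\<And>i. l i \<in> {-1..1}"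
    and lim': "\<And>i. (\<lambda>k. if i < 2 * n + 2 then L (r (s k)) ! i else 0) \<longlonglongrightarrow> l i" by blast
  have lim: "(\<lambda>k. L (r (s k)) ! i) \<longlonglongrightarrow> l i" if "i < 2 * n + 2" for i using lim'[of i] that by simp
  have u: "strict_mono (\<lambda>k. r (s k))" using strict_mono_o[OF r s] by (simp add: o_def)
  have flim: "(\<lambda>k. \<phi> (r (s k)) (L (r (s k)) ! i)) \<longlonglongrightarrow> f (l i)" if "i < 2 * n + 2" for i
    using L(7)[OF that] by (intro conv[OF u] lim that) blast
  have ext: "l i \<in> extremals f" if i: "i < 2 * n + 2" for i
  proof -
    have "\<bar>f z\<bar> \<le> \<bar>f (l i)\<bar>" if z: "z \<in> {-1..1}" for z
    proof (rule LIMSEQ_le)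
      show "(\<lambda>k. \<bar>\<phi> (r (s k)) z\<bar>) \<longlonglongrightarrow> \<bar>f z\<bar>"
        by (intro tendsto_rabs conv[OF u]) (use z in auto)
      show "(\<lambda>k. \<bar>\<phi> (r (s k)) (L (r (s k)) ! i)\<bar>) \<longlonglongrightarrow> \<bar>f (l i)\<bar>"
        by (intro tendsto_rabs flim i)
      have "\<bar>\<phi> k z\<bar> \<le> \<bar>\<phi> k (L k ! i)\<bar>" for k
        using max_norm_le_iff[OF cont(2), of k "max_norm (\<phi> k)"] L(7)[OF i, of k] z by auto
      then show "\<exists>N. \<forall>k\<ge>N. \<bar>\<phi> (r (s k)) z\<bar> \<le> \<bar>\<phi> (r (s k)) (L (r (s k)) ! i)\<bar>" by blast
    qed
    then have "max_norm f \<le> \<bar>f (l i)\<bar>" by (simp add: max_norm_le_iff[OF cont(1)])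
    moreover have "\<bar>f (l i)\<bar> \<le> max_norm f"
      using max_norm_le_iff[OF cont(1), of "max_norm f"] l[of i] by auto
    ultimately show ?thesis using l[of i] by (simp add: extremals_def)
  qed
  have less: "l i < l (Suc i)" if i: "Suc i < 2 * n + 2" for i
  proof -
    have "l i \<le> l (Suc i)"
      by (rule LIMSEQ_le[OF lim lim]) (use i L(6)[of i] in \<open>auto intro: less_imp_le\<close>)
    moreover have "f (l (Suc i)) = - f (l i)"
    proof (rule LIMSEQ_unique[OF flim[OF i]])
      have "(\<lambda>k. - \<phi> (r (s k)) (L (r (s k)) ! i)) \<longlonglongrightarrow> - f (l i)"
        using i by (intro tendsto_minus flim) simp
      then show "(\<lambda>k. \<phi> (r (s k)) (L (r (s k)) ! Suc i)) \<longlonglongrightarrow> - f (l i)"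
        using L(6)[of i] i by simp
    qed
    moreover have "f (l i) \<noteq> 0" using ext[of i] i pos by (auto simp: extremals_def)
    ultimately show ?thesis by (metis less_eq_real_def neg_equal_iff_equal equal_neg_zero)
  qed
  define K where "K = map l [0..<2 * n + 2]"
  have sK: "sorted_wrt (<) K"
    unfolding K_def by (subst sorted_wrt_iff_nth_Suc_transp) (use less in \<open>auto simp del: upt_Suc\<close>)
  have sub: "set K \<subseteq> extremals f" using ext by (auto simp: K_def)
  have fin: "finite (extremals f)" and card: "card (extremals f) = 2 * n + 2"
    using f by (auto simp: equioscillating_def intro: card_ge_0_finite)
  have "card (set K) = 2 * n + 2"
    using sK by (subst distinct_card) (auto simp: K_def strict_sorted_iff simp del: upt_Suc)
  then have "set K = extremals f" using card_subset_eq[OF fin sub] card by simp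
  then have "K = sorted_list_of_set (extremals f)"
    using strict_sorted_equal[OF sK, of "sorted_list_of_set (extremals f)"] fin by simp
  then have "sorted_list_of_set (extremals f) ! j = l j"
    using j by (metis K_def add.left_neutral diff_zero length_map length_upt nth_map nth_upt)
  then show "\<exists>s. strict_mono s \<and> (\<lambda>k. sorted_list_of_set (extremals (\<phi> (r (s k)))) ! j)
      \<longlonglongrightarrow> sorted_list_of_set (extremals f) ! j"
    using s lim[OF j] unfolding L_def by auto
qed

text \<open>An accumulation point of the zeros is a zero of \<open>f\<close> between two neighbouring extremal points,
and it is different from these because \<open>f\<close> does not vanish there.\<close>

lemma zero_tendsto:
  fixes \<phi> :: "nat \<Rightarrow> real \<Rightarrow> real"
  assumes f: "equioscillating n f" "\<And>k. equioscillating n (\<phi> k)"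
    and conv: "\<And>(s :: nat \<Rightarrow> nat) x l. strict_mono s \<Longrightarrow> (\<And>k. x k \<in> {-1..1}) \<Longrightarrow> x \<longlonglongrightarrow> l
      \<Longrightarrow> (\<lambda>k. \<phi> (s k) (x k)) \<longlonglongrightarrow> f l"
    and j: "j < 2 * n + 1"
    and Z: "\<And>k. Z k \<in> {sorted_list_of_set (extremals (\<phi> k)) ! j <..< sorted_list_of_set (extremals (\<phi> k)) ! Suc j}"
      "\<And>k. \<phi> k (Z k) = 0"
    and z: "z \<in> {sorted_list_of_set (extremals f) ! j <..< sorted_list_of_set (extremals f) ! Suc j}" "f z = 0"
  shows "Z \<longlonglongrightarrow> z"
proof (rule LIMSEQ_if_subseq)
  fix r :: "nat \<Rightarrow> nat" assume r: "strict_mono r"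
  define L where "L k = sorted_list_of_set (extremals (\<phi> k))" for k
  define L0 where "L0 = sorted_list_of_set (extremals f)"
  note L = equioscillating_list[OF f(2), folded L_def]
  note L0 = equioscillating_list[OF f(1), folded L0_def]
  have pos: "max_norm f > 0" using f by (simp add: equioscillating_def)
  have Lz: "L k ! j < Z k" "Z k < L k ! Suc j" for k using Z(1)[of k] by (auto simp: L_def)
  have Zin: "Z k \<in> {-1..1}" for k using Lz[of k] L(7)[of j k] L(7)[of "Suc j" k] j by auto
  have "seq_compact {-1..1::real}" by (simp add: compact_imp_seq_compact)
  moreover have "\<forall>k. Z (r k) \<in> {-1..1}" using Zin by blast
  ultimately obtain l s where s: "strict_mono s" and l: "((\<lambda>k. Z (r k)) \<circ> s) \<longlonglongrightarrow> l"
    unfolding seq_compact_def by metis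
  then have l: "(\<lambda>k. Z (r (s k))) \<longlonglongrightarrow> l" by (simp add: o_def)
  have u: "strict_mono (\<lambda>k. r (s k))" using strict_mono_o[OF r s] by (simp add: o_def)
  have "(\<lambda>k. \<phi> (r (s k)) (Z (r (s k)))) \<longlonglongrightarrow> f l" using Zin by (intro conv[OF u] l)
  then have fl: "f l = 0" using Z(2) by (simp add: LIMSEQ_const_iff)
  have Llim: "(\<lambda>k. L (r (s k)) ! i) \<longlonglongrightarrow> L0 ! i" if "i < 2 * n + 2" for i
    using LIMSEQ_subseq_LIMSEQ[OF extremal_tendsto[OF f(2,1) conv that] u] by (simp add: o_def L_def L0_def)
  have "L0 ! j \<le> l"
    by (rule LIMSEQ_le[OF Llim l]) (use j Lz in \<open>auto intro: less_imp_le\<close>)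
  moreover have "l \<le> L0 ! Suc j"
    by (rule LIMSEQ_le[OF l Llim]) (use j Lz in \<open>auto intro: less_imp_le\<close>)
  moreover have "f (L0 ! j) \<noteq> 0" "f (L0 ! Suc j) \<noteq> 0" using L0(7)[of j] L0(7)[of "Suc j"] j pos by auto
  then have "l \<noteq> L0 ! j" "l \<noteq> L0 ! Suc j" using fl by auto
  ultimately have "l \<in> {L0 ! j<..<L0 ! Suc j}" by simp
  then have "l = z" using L0(6)[OF j] z fl by (auto simp: L0_def)
  then show "\<exists>s. strict_mono s \<and> (\<lambda>k. Z (r (s k))) \<longlonglongrightarrow> z" using s l by auto
qed

lemma equioscillation_point_eq:
  assumes "equioscillating n (phase_error n \<omega>)"
  shows "equioscillation_point n \<omega> j = sorted_list_of_set (extremals (phase_error n \<omega>)) ! (j - 1)"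
proof -
  define L where "L = sorted_list_of_set (extremals (phase_error n \<omega>))"
  note L = equioscillating_list[OF assms, folded L_def]
  have "is_equioscillation_list n \<omega> L"
    using L unfolding is_equioscillation_list_def extremals_def by (simp add: sgn_minus)
  moreover have "hs = L" if "is_equioscillation_list n \<omega> hs" for hs
    using that strict_sorted_equal[OF L(2), of hs] L(3)
    by (simp add: is_equioscillation_list_def extremals_def)
  ultimately have "(THE hs. is_equioscillation_list n \<omega> hs) = L" by (rule the_equality)
  then show ?thesis by (simp add: equioscillation_point_def L_def)
qed

theorem proposition7p6:
  fixes n :: nat
  assumes "n \<ge> 1"
  shows "(\<forall>j\<in>{1..2 * n + 2}.
           continuous_on {0<..<(real n + 1) * pi} (\<lambda>\<omega>. equioscillation_point n \<omega> j)) \<and>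
         (\<forall>j\<in>{1..2 * n + 1}.
           continuous_on {0<..<(real n + 1) * pi} (\<lambda>\<omega>. interpolation_node n \<omega> j))"
proof -
  define U where "U = {0<..<(real n + 1) * pi}"
  define L where "L \<omega> = sorted_list_of_set (extremals (phase_error n \<omega>))" for \<omega>
  have eq: "equioscillating n (phase_error n \<omega>)" if "\<omega> \<in> U" for \<omega>
    using phase_error_equioscillating[of \<omega> n] that by (simp add: U_def)
  have pt: "equioscillation_point n \<omega> j = L \<omega> ! (j - 1)" if "\<omega> \<in> U" for \<omega> j
    unfolding L_def by (rule equioscillation_point_eq[OF eq[OF that]])
  have conv: "(\<lambda>k. phase_error n (\<Omega> (s k)) (x k)) \<longlonglongrightarrow> phase_error n \<omega> l"
    if "\<And>k. \<Omega> k \<in> U" "\<omega> \<in> U" "\<Omega> \<longlonglongrightarrow> \<omega>" "strict_mono s" "\<And>k. x k \<in> {-1..1}" "x \<longlonglongrightarrow> l"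
    for \<Omega> \<omega> and s :: "nat \<Rightarrow> nat" and x l
    using phase_error_tendsto[of "\<lambda>k. \<Omega> (s k)" n \<omega> x l] that LIMSEQ_subseq_LIMSEQ[OF that(3,4)]
    by (simp add: U_def o_def)
  have "continuous_on U (\<lambda>\<omega>. equioscillation_point n \<omega> j)" if "j \<in> {1..2 * n + 2}" for j
    unfolding continuous_on_sequentially o_def
  proof (intro allI ballI impI, elim conjE)
    fix \<Omega> \<omega> assume \<Omega>: "\<omega> \<in> U" "\<forall>k. \<Omega> k \<in> U" "\<Omega> \<longlonglongrightarrow> \<omega>"
    have "(\<lambda>k. L (\<Omega> k) ! (j - 1)) \<longlonglongrightarrow> L \<omega> ! (j - 1)"
      unfolding L_def
    proof (rule extremal_tendsto)
      show "j - 1 < 2 * n + 2" using that by auto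
    qed (use \<Omega> eq conv in auto)
    then show "(\<lambda>k. equioscillation_point n (\<Omega> k) j) \<longlonglongrightarrow> equioscillation_point n \<omega> j"
      using \<Omega> by (simp add: pt)
  qed
  moreover have "continuous_on U (\<lambda>\<omega>. interpolation_node n \<omega> j)" if j: "j \<in> {1..2 * n + 1}" for j
  proof -
    have less: "j - 1 < 2 * n + 1" using j by auto
    have zero: "phase_error_zero n \<omega> j \<in> {L \<omega> ! (j - 1)<..<L \<omega> ! Suc (j - 1)}"
      "phase_error n \<omega> (phase_error_zero n \<omega> j) = 0" if \<omega>: "\<omega> \<in> U" for \<omega>
    proof -
      have "\<exists>!x. x \<in> {L \<omega> ! (j - 1)<..<L \<omega> ! Suc (j - 1)} \<and> phase_error n \<omega> x = 0"
        unfolding L_def using equioscillating_list(6)[OF eq[OF \<omega>], of "j - 1"] less by blast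
      from theI'[OF this] show "phase_error_zero n \<omega> j \<in> {L \<omega> ! (j - 1)<..<L \<omega> ! Suc (j - 1)}"
        "phase_error n \<omega> (phase_error_zero n \<omega> j) = 0"
        using j unfolding phase_error_zero_def pt[OF \<omega>] by simp_all
    qed
    have "continuous_on U (\<lambda>\<omega>. phase_error_zero n \<omega> j)"
      unfolding continuous_on_sequentially o_def
    proof (intro allI ballI impI, elim conjE)
      fix \<Omega> \<omega> assume \<Omega>: "\<omega> \<in> U" "\<forall>k. \<Omega> k \<in> U" "\<Omega> \<longlonglongrightarrow> \<omega>"
      show "(\<lambda>k. phase_error_zero n (\<Omega> k) j) \<longlonglongrightarrow> phase_error_zero n \<omega> j"
      proof (rule zero_tendsto[where f = "phase_error n \<omega>" and \<phi> = "\<lambda>k. phase_error n (\<Omega> k)" and j = "j - 1" and n = n])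
        show "j - 1 < 2 * n + 1" by (rule less)
      qed (use \<Omega> eq conv zero in \<open>auto simp: L_def\<close>)
    qed
    then show ?thesis unfolding interpolation_node_def by (intro continuous_intros)
  qed
  ultimately show ?thesis unfolding U_def by blast
qed

end
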